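(* Assume that there exists $\delta>0$ such that $\mathbb{E}(|Y_1|^{2+\delta})<\infty$ and $\sum_{k=1}^{\infty}\alpha_Y(k)^{\delta/(2+\delta)}<\infty$. Let $\mu:[0,1]\to\mathbb{R}$ be an arbitrary (constant or non-constant) càdlàg function. Then $$U(n)\longrightarrow \int_0^1\int_0^1 |\mu(x)-\mu(y)|\,\mathrm{d}x\,\mathrm{d}y\quad\text{in } L^2 \text{ as } n\to\infty .$$
   Context: $(Y_i)_{i\in\mathbb{N}}$ is a strictly stationary real-valued process with $\mathbb{E}(Y_1)=0$, $\mathrm{Var}(Y_1)=1$. For $\sigma$-fields $\mathcal{A},\mathcal{B}$ let $\alpha(\mathcal{A},\mathcal{B})=\sup\{|\mathbb{P}(A)\mathbb{P}(B)-\mathbb{P}(A\cap B)|:A\in\mathcal{A},B\in\mathcal{B}\}$ and $\alpha_Y(k)=\sup_{m\in\mathbb{N}}\alpha(\sigma(Y_1,\dots,Y_m),\sigma(Y_{k+m},Y_{k+m+1},\dots))$; $(Y_i)$ is $\alpha$-mixing, i.e. $\alpha_Y(k)\to0$. The long run variance $\kappa_Y^2=\mathrm{Var}(Y_1)+2\sum_{k=1}^\infty\mathrm{Cov}(Y_1,Y_{k+1})$ (finite under the moment and mixing assumptions made) satisfies $\kappa_Y^2>0$. Observations: $X_i=X_{i,n}=\mu(i/n)+\sigma(i/n)Y_i$, $i=1,\dots,n$, where $\mu:[0,1]\to\mathbb{R}$ is càdlàg and $\sigma:[0,1]\to(0,\infty)$ is càdlàg and piecewise Lipschitz-continuous (the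 sum of a Lipschitz-continuous function and a piecewise constant function with a fixed finite number of jumps), with $\sigma(x)\ge\sigma_0$ for all $x\in[0,1]$ and some $\sigma_0>0$. Blocks: $\ell_n=n^s$, $b_n=n^{1-s}$ with $s\in(0.5,1)$; both are assumed to be integers. Local means $\hat\mu_j=\hat\mu_{j,n}=\frac1{\ell_n}\sum_{i=(j-1)\ell_n+1}^{j\ell_n}X_i$, $1\le j\le b_n$, and $$U(n)=\frac{1}{b_n(b_n-1)}\sum_{1\le j\ne k\le b_n}|\hat\mu_j-\hat\mu_k| .$$ *)

theory Defs
  imports "HOL-Probability.Probability"
begin

text \<open>
  Conventions.  All time indices start at 1, so for a process \<open>Y :: nat \<Rightarrow> 'a \<Rightarrow> real\<close> the
  variable \<open>Y 0\<close> is unused.  Functions on the unit interval are total functions on the reals whose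
  values outside \<open>{0..1}\<close> are unused.
\<close>

subsection \<open>Functions on the unit interval\<close>

text \<open>At a point of \<open>{0..<1}\<close> (respectively \<open>{0<..1}\<close>) the filter \<open>at_right\<close> (respectively
  \<open>at_left\<close>) only sees points of the unit interval.\<close>

definition cadlag01 :: "(real \<Rightarrow> real) \<Rightarrow> bool" where
  "cadlag01 f \<longleftrightarrow>
     (\<forall>x\<in>{0..<1}. (f \<longlongrightarrow> f x) (at_right x)) \<and>
     (\<forall>x\<in>{0<..1}. \<exists>l. (f \<longlongrightarrow> l) (at_left x))"

text \<open>The finite set \<open>T\<close> contains the jump points; the values at the jump points themselves are
  not restricted.\<close>

definition piecewise_constant01 :: "(real \<Rightarrow> real) \<Rightarrow> bool" where
  "piecewise_constant01 h \<longleftrightarrow>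
     (\<exists>T. finite T \<and>
        (\<forall>x y. 0 \<le> x \<longrightarrow> x \<le> y \<longrightarrow> y \<le> 1 \<longrightarrow> {x..y} \<inter> T = {} \<longrightarrow> h x = h y))"

definition piecewise_lipschitz01 :: "(real \<Rightarrow> real) \<Rightarrow> bool" where
  "piecewise_lipschitz01 f \<longleftrightarrow>
     (\<exists>g h L. L-lipschitz_on {0..1} g \<and> piecewise_constant01 h \<and> (\<forall>x\<in>{0..1}. f x = g x + h x))"

subsection \<open>Stationary and mixing processes\<close>

definition strictly_stationary :: "'a measure \<Rightarrow> (nat \<Rightarrow> 'a \<Rightarrow> real) \<Rightarrow> bool" where
  "strictly_stationary M Y \<longleftrightarrow>
     (\<forall>i\<ge>1. Y i \<in> borel_measurable M) \<and>
     (\<forall>m\<ge>1. \<forall>h.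
        distr M (Pi\<^sub>M {1..m} (\<lambda>_. borel)) (\<lambda>\<omega>. \<lambda>i\<in>{1..m}. Y (i + h) \<omega>) =
        distr M (Pi\<^sub>M {1..m} (\<lambda>_. borel)) (\<lambda>\<omega>. \<lambda>i\<in>{1..m}. Y i \<omega>))"

definition sigma_gen :: "'a measure \<Rightarrow> (nat \<Rightarrow> 'a \<Rightarrow> real) \<Rightarrow> nat set \<Rightarrow> 'a set set" where
  "sigma_gen M Y I =
     sigma_sets (space M) {Y i -` B \<inter> space M | i B. i \<in> I \<and> B \<in> sets borel}"

text \<open>Both suprema below are over nonempty sets of reals in \<open>{0..1}\<close> when \<open>M\<close> is a probability
  space.\<close>

definition alpha_coeff :: "'a measure \<Rightarrow> 'a set set \<Rightarrow> 'a set set \<Rightarrow> real" where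
  "alpha_coeff M \<A> \<B> =
     (SUP (A, B) \<in> \<A> \<times> \<B>. \<bar>measure M A * measure M B - measure M (A \<inter> B)\<bar>)"

definition alpha_mix :: "'a measure \<Rightarrow> (nat \<Rightarrow> 'a \<Rightarrow> real) \<Rightarrow> nat \<Rightarrow> real" where
  "alpha_mix M Y k =
     (SUP m\<in>{1..}. alpha_coeff M (sigma_gen M Y {1..m}) (sigma_gen M Y {k + m..}))"

definition alpha_mixing :: "'a measure \<Rightarrow> (nat \<Rightarrow> 'a \<Rightarrow> real) \<Rightarrow> bool" where
  "alpha_mixing M Y \<longleftrightarrow> alpha_mix M Y \<longlonglongrightarrow> 0"

definition covariance :: "'a measure \<Rightarrow> ('a \<Rightarrow> real) \<Rightarrow> ('a \<Rightarrow> real) \<Rightarrow> real" where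
  "covariance M V W =
     prob_space.expectation M
       (\<lambda>\<omega>. (V \<omega> - prob_space.expectation M V) * (W \<omega> - prob_space.expectation M W))"

text \<open>The series over \<open>k \<ge> 1\<close> is written with \<open>Suc k\<close> in place of \<open>k\<close>.\<close>

definition long_run_variance :: "'a measure \<Rightarrow> (nat \<Rightarrow> 'a \<Rightarrow> real) \<Rightarrow> real" where
  "long_run_variance M Y =
     prob_space.variance M (Y 1) + 2 * (\<Sum>k. covariance M (Y 1) (Y (Suc k + 1)))"

subsection \<open>Observations, blocks and the statistic\<close>

definition obs ::
  "(real \<Rightarrow> real) \<Rightarrow> (real \<Rightarrow> real) \<Rightarrow> (nat \<Rightarrow> 'a \<Rightarrow> real) \<Rightarrow> nat \<Rightarrow> nat \<Rightarrow> 'a \<Rightarrow> real" where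
  "obs \<mu> \<sigma> Y n i \<omega> = \<mu> (real i / real n) + \<sigma> (real i / real n) * Y i \<omega>"

text \<open>The block length \<open>n powr s\<close> and the number of blocks \<open>n powr (1 - s)\<close> are assumed to be
  integers.  For fixed \<open>s\<close> this cannot hold for every \<open>n\<close>, so limits are taken along the
  \<open>n\<close> for which it does; for these \<open>n\<close> the floors below are exact.\<close>

definition admissible_sizes :: "real \<Rightarrow> nat set" where
  "admissible_sizes s = {n. real n powr s \<in> \<nat> \<and> real n powr (1 - s) \<in> \<nat>}"

definition block_length :: "real \<Rightarrow> nat \<Rightarrow> nat" where
  "block_length s n = nat \<lfloor>real n powr s\<rfloor>"

definition block_count :: "real \<Rightarrow> nat \<Rightarrow> nat" where
  "block_count s n = nat \<lfloor>real n powr (1 - s)\<rfloor>"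

definition admissible_at_top :: "real \<Rightarrow> nat filter" where
  "admissible_at_top s = inf sequentially (principal (admissible_sizes s))"

definition local_mean :: "nat \<Rightarrow> (nat \<Rightarrow> 'a \<Rightarrow> real) \<Rightarrow> nat \<Rightarrow> 'a \<Rightarrow> real" where
  "local_mean l X j \<omega> = (\<Sum>i = (j - 1) * l + 1..j * l. X i \<omega>) / real l"

definition gini_stat :: "nat \<Rightarrow> nat \<Rightarrow> (nat \<Rightarrow> 'a \<Rightarrow> real) \<Rightarrow> 'a \<Rightarrow> real" where
  "gini_stat l b X \<omega> =
     1 / (real b * (real b - 1)) *
       (\<Sum>(j, k) \<in> {(j, k). j \<in> {1..b} \<and> k \<in> {1..b} \<and> j \<noteq> k}.
          \<bar>local_mean l X j \<omega> - local_mean l X k \<omega>\<bar>)"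

definition U_stat ::
  "(real \<Rightarrow> real) \<Rightarrow> (real \<Rightarrow> real) \<Rightarrow> (nat \<Rightarrow> 'a \<Rightarrow> real) \<Rightarrow> real \<Rightarrow> nat \<Rightarrow> 'a \<Rightarrow> real" where
  "U_stat \<mu> \<sigma> Y s n = gini_stat (block_length s n) (block_count s n) (obs \<mu> \<sigma> Y n)"

subsection \<open>Convergence in mean square\<close>

text \<open>Square integrability is required explicitly because the Bochner integral of a non-integrable
  function is 0.\<close>

definition tendsto_in_L2 ::
  "'a measure \<Rightarrow> 'b filter \<Rightarrow> ('b \<Rightarrow> 'a \<Rightarrow> real) \<Rightarrow> ('a \<Rightarrow> real) \<Rightarrow> bool" where
  "tendsto_in_L2 M F Z V \<longleftrightarrow>
     (\<forall>\<^sub>F n in F. Z n \<in> borel_measurable M \<and> integrable M (\<lambda>\<omega>. (Z n \<omega>)\<^sup>2)) \<and>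
     V \<in> borel_measurable M \<and> integrable M (\<lambda>\<omega>. (V \<omega>)\<^sup>2) \<and>
     ((\<lambda>n. integral\<^sup>L M (\<lambda>\<omega>. (Z n \<omega> - V \<omega>)\<^sup>2)) \<longlongrightarrow> 0) F"

end

theory Submission
  imports Defs
begin

text \<open>
  Write the \<open>j\<close>-th local mean as \<open>m\<^sub>j + e\<^sub>j\<close>, where \<open>m\<^sub>j\<close> averages \<open>\<mu>\<close> and \<open>e\<^sub>j\<close> averages the noise
  \<open>\<sigma> Y\<close> over the block.  By the triangle inequality, replacing the local means by the \<open>m\<^sub>j\<close> changes
  the statistic by at most \<open>2 / b \<Sum>\<^sub>j \<bar>e\<^sub>j\<bar>\<close>, whose second moment is at most \<open>4 max\<^sub>j E e\<^sub>j\<^sup>2\<close>.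

  Since \<open>\<sigma>\<close> is bounded, \<open>E e\<^sub>j\<^sup>2\<close> is at most a constant times the Cesaro mean of \<open>\<bar>E Y\<^sub>1 Y\<^sub>1\<^sub>+\<^sub>k\<bar>\<close>,
  \<open>k < l\<close>, so it suffices that these covariances tend to 0.  No rate and no covariance inequality is
  needed for that: approximate \<open>Y\<^sub>1\<close> in mean square by a function \<open>s (Y\<^sub>1)\<close> with finitely many values,
  for which mixing bounds the covariance directly.

  The remaining deterministic statistic is, up to the factor \<open>b / (b - 1)\<close>, the double integral of
  \<open>\<bar>F x - F y\<bar>\<close> for a uniformly bounded step function \<open>F\<close> that converges to \<open>\<mu>\<close> at every continuity
  point of \<open>\<mu>\<close>, hence almost everywhere, because a cadlag function has countably many jumps.
\<close>

subsection \<open>Cadlag functions\<close>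

text \<open>One-sided limits bound \<open>f\<close> near every point of the unit interval, and by
  compactness finitely many such neighbourhoods cover it.\<close>

lemma cadlag01_bounded:
  assumes "cadlag01 f"
  obtains K where "K > 0" "\<And>x. x \<in> {0..1} \<Longrightarrow> \<bar>f x\<bar> \<le> K"
proof -
  have side: "\<exists>K. \<forall>\<^sub>F y in F. \<bar>f y\<bar> \<le> K" if "(f \<longlongrightarrow> l) F" for F l
  proof -
    have "\<forall>\<^sub>F y in F. dist (f y) l < 1"
      using that by (auto simp: tendsto_iff)
    then have "\<forall>\<^sub>F y in F. \<bar>f y\<bar> \<le> \<bar>l\<bar> + 1"
      by eventually_elim (auto simp: dist_real_def)
    then show ?thesis by blast
  qed
  have loc: "\<exists>U K. open U \<and> x \<in> U \<and> (\<forall>y\<in>U \<inter> {0..1}. \<bar>f y\<bar> \<le> K)" if x: "x \<in> {0..1}" for x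
  proof -
    have "\<exists>K. \<forall>\<^sub>F y in at_right x. y \<in> {0..1} \<longrightarrow> \<bar>f y\<bar> \<le> K"
    proof (cases "x < 1")
      case True
      then obtain K where "\<forall>\<^sub>F y in at_right x. \<bar>f y\<bar> \<le> K"
        using assms x side[of "f x" "at_right x"] by (auto simp: cadlag01_def)
      then show ?thesis by (intro exI[of _ K]) (auto elim: eventually_mono)
    next
      case False
      \<comment> \<open>No point of the unit interval lies to the right of \<open>x\<close>, so any
        constant serves as a bound there.\<close>
      then show ?thesis
        by (intro exI[of _ 0]) (auto simp: eventually_at_filter intro!: always_eventually)
    qed
    then obtain K1 where K1: "\<forall>\<^sub>F y in at_right x. y \<in> {0..1} \<longrightarrow> \<bar>f y\<bar> \<le> K1" ..
    have "\<exists>K. \<forall>\<^sub>F y in at_left x. y \<in> {0..1} \<longrightarrow> \<bar>f y\<bar> \<le> K"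
    proof (cases "0 < x")
      case True
      then obtain l where "(f \<longlongrightarrow> l) (at_left x)"
        using assms x unfolding cadlag01_def by force
      from side[OF this] obtain K where "\<forall>\<^sub>F y in at_left x. \<bar>f y\<bar> \<le> K" ..
      then show ?thesis by (intro exI[of _ K]) (auto elim: eventually_mono)
    next
      case False
      then show ?thesis
        by (intro exI[of _ 0]) (auto simp: eventually_at_filter intro!: always_eventually)
    qed
    then obtain K2 where K2: "\<forall>\<^sub>F y in at_left x. y \<in> {0..1} \<longrightarrow> \<bar>f y\<bar> \<le> K2" ..
    \<comment> \<open>The two one-sided bounds say nothing about \<open>x\<close> itself, hence the
      term \<open>\<bar>f x\<bar>\<close>; with it the bound passes from \<open>at x\<close> to
      \<open>nhds x\<close>.\<close>
    define K where "K = max (\<bar>f x\<bar>) (max K1 K2)"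
    have "\<forall>\<^sub>F y in at x. y \<in> {0..1} \<longrightarrow> \<bar>f y\<bar> \<le> K"
      unfolding eventually_at_split
      using K1 K2 by (auto elim!: eventually_mono simp: K_def)
    then have "\<forall>\<^sub>F y in nhds x. y \<in> {0..1} \<longrightarrow> \<bar>f y\<bar> \<le> K"
      by (auto simp: eventually_at_filter K_def elim!: eventually_mono)
    then show ?thesis
      unfolding eventually_nhds by blast
  qed
  then obtain U K where UK: "\<And>x. x \<in> {0..1} \<Longrightarrow> open (U x) \<and> x \<in> U x \<and> (\<forall>y\<in>U x \<inter> {0..1}. \<bar>f y\<bar> \<le> K x)"
    by metis
  obtain C where C: "C \<subseteq> {0..1}" "finite C" "{0..1::real} \<subseteq> (\<Union>c\<in>C. U c)"
    using compactE_image[of "{0..1::real}" "{0..1}" U] UK compact_Icc by blast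
  show thesis
  proof (rule that)
    \<comment> \<open>The sum dominates every \<open>K c\<close> with \<open>c \<in> C\<close>; the
      added 1 only makes the constant strictly positive.\<close>
    show "(\<Sum>c\<in>C. \<bar>K c\<bar>) + 1 > 0"
      by (smt (verit) sum_nonneg)
    fix x :: real assume x: "x \<in> {0..1}"
    then obtain c where c: "c \<in> C" "x \<in> U c" using C by blast
    have "\<bar>f x\<bar> \<le> K c" using UK[of c] c x C by blast
    also have "\<dots> \<le> (\<Sum>c\<in>C. \<bar>K c\<bar>)"
      using member_le_sum[of c C "\<lambda>c. \<bar>K c\<bar>"] c C by auto
    finally show "\<bar>f x\<bar> \<le> (\<Sum>c\<in>C. \<bar>K c\<bar>) + 1" by simp
  qed
qed

text \<open>An upward jump at \<open>x\<close> is recorded by rationals \<open>p\<close> between the left limit and \<open>f x\<close>,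
  and \<open>r < x\<close> with \<open>f < p\<close> on \<open>(r, x)\<close>; two points cannot share such a record.\<close>

lemma countable_left_jumps_up:
  fixes f :: "real \<Rightarrow> real"
  shows "countable {x. \<exists>l. (f \<longlongrightarrow> l) (at_left x) \<and> l < f x}"
proof (rule countable_subset)
  let ?J = "\<lambda>p r::real. {x. r < x \<and> (\<forall>y. r < y \<and> y < x \<longrightarrow> f y < p) \<and> p < f x}"
  show "countable (\<Union>p\<in>\<rat>. \<Union>r\<in>\<rat>. ?J p r)"
  proof (intro countable_UN countable_rat)
    fix p r :: real
    have eq: "x = y" if "x \<in> ?J p r" "y \<in> ?J p r" for x y
    proof (rule ccontr)
      assume "x \<noteq> y"
      then consider "x < y" | "y < x" by linarith
      moreover have "r < x" "\<forall>z. r < z \<and> z < x \<longrightarrow> f z < p" "p < f x"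
        "r < y" "\<forall>z. r < z \<and> z < y \<longrightarrow> f z < p" "p < f y"
        using that by simp_all
      \<comment> \<open>The smaller of the two points lies in the interval on which the larger one
        forces \<open>f < p\<close>, although its own value exceeds \<open>p\<close>.\<close>
      ultimately show False
        by cases (meson less_asym)+
    qed
    show "countable (?J p r)"
    proof (cases "?J p r = {}")
      case False
      then obtain x where "x \<in> ?J p r" by blast
      then have "?J p r \<subseteq> {x}" using eq by (intro subsetI) simp
      then show ?thesis by (rule countable_subset) simp
    qed (simp only: countable_empty)
  qed
  show "{x. \<exists>l. (f \<longlongrightarrow> l) (at_left x) \<and> l < f x} \<subseteq> (\<Union>p\<in>\<rat>. \<Union>r\<in>\<rat>. ?J p r)"
  proof clarify
    fix x l assume l: "(f \<longlongrightarrow> l) (at_left x)" "l < f x"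
    obtain p where p: "p \<in> \<rat>" "l < p" "p < f x"
      using Rats_dense_in_real[OF l(2)] by blast
    have "\<forall>\<^sub>F y in at_left x. f y < p"
      using order_tendstoD(2)[OF l(1) p(2)] .
    then obtain b where b: "b < x" "\<And>y. b < y \<Longrightarrow> y < x \<Longrightarrow> f y < p"
      unfolding eventually_at_left_field by blast
    obtain r where r: "r \<in> \<rat>" "b < r" "r < x"
      using Rats_dense_in_real[OF b(1)] by blast
    show "x \<in> (\<Union>p\<in>\<rat>. \<Union>r\<in>\<rat>. ?J p r)"
    proof (rule UN_I[OF p(1) UN_I[OF r(1)]])
      show "x \<in> ?J p r" using p r b by simp
    qed
  qed
qed

text \<open>By right-continuity, a discontinuity inside the interval means that the left limit
  differs from the value. Downward jumps of \<open>f\<close> are upward jumps of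
  \<open>- f\<close>.\<close>

lemma cadlag01_countable_discont:
  assumes "cadlag01 f"
  shows "countable {x \<in> {0<..<1}. \<not> isCont f x}"
proof (rule countable_subset)
  let ?J = "\<lambda>f::real \<Rightarrow> real. {x. \<exists>l. (f \<longlongrightarrow> l) (at_left x) \<and> l < f x}"
  show "countable (?J f \<union> ?J (\<lambda>x. - f x))"
    by (intro countable_Un countable_left_jumps_up)
  show "{x \<in> {0<..<1}. \<not> isCont f x} \<subseteq> ?J f \<union> ?J (\<lambda>x. - f x)"
  proof
    fix x assume x: "x \<in> {x \<in> {0<..<1}. \<not> isCont f x}"
    then have r: "(f \<longlongrightarrow> f x) (at_right x)" and "\<exists>l. (f \<longlongrightarrow> l) (at_left x)"
      using assms by (auto simp: cadlag01_def)
    then obtain l where l: "(f \<longlongrightarrow> l) (at_left x)" by blast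
    have "l \<noteq> f x"
      using x r l by (auto simp: isCont_def filterlim_split_at)
    then show "x \<in> ?J f \<union> ?J (\<lambda>x. - f x)"
      using l tendsto_minus[OF l] by (cases "l < f x") force+
  qed
qed

text \<open>Values of \<open>f\<close> outside the unit interval are arbitrary, so \<open>f\<close>
  is first cut off to 0 there. The cut-off may add jumps at the endpoints only, and countably many
  discontinuities do not destroy measurability.\<close>

lemma cadlag01_measurable:
  assumes "cadlag01 f"
  shows "(\<lambda>x. indicator {0..1} x * f x) \<in> borel_measurable borel"
proof (rule borel_measurable_continuous_countable_exceptions)
  let ?X = "{x \<in> {0<..<1}. \<not> isCont f x} \<union> {0, 1}"
  show "countable ?X"
    using cadlag01_countable_discont[OF assms] by simp
  have "isCont (\<lambda>x. indicator {0..1} x * f x) x" if x: "x \<in> - ?X" for x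
  proof (cases "x \<in> {0<..<1}")
    case True
    then have "\<forall>\<^sub>F y in nhds x. f y = indicator {0..1} y * f y"
      by (intro eventually_nhds_in_open[of "{0<..<1}", THEN eventually_mono]) auto
    moreover have "isCont f x" using True x by auto
    ultimately show ?thesis by (rule iffD1[OF isCont_cong])
  next
    case False
    then have "\<forall>\<^sub>F y in nhds x. 0 = indicator {0..1} y * f y"
      using x by (intro eventually_nhds_in_open[of "- {0..1}", THEN eventually_mono]) auto
    then show ?thesis by (rule iffD1[OF isCont_cong continuous_const])
  qed
  then show "continuous_on (- ?X) (\<lambda>x. indicator {0..1} x * f x)"
    by (intro continuous_at_imp_continuous_on) blast
qed

section \<open>Integrals of step functions and their limits\<close>

lemma set_integral_step:
  fixes F :: "nat \<Rightarrow> real"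
  assumes "b > 0"
  shows "(LBINT x:{0..1}. F (nat \<lceil>real b * x\<rceil>)) = (\<Sum>j=1..b. F j) / real b"
proof -
  \<comment> \<open>The cells are half-open on the left because the ceiling assigns the index
    \<open>j\<close> exactly to the points with \<open>j - 1 < b * x \<le> j\<close>.\<close>
  let ?I = "\<lambda>j::nat. {(real j - 1) / real b<..real j / real b}"
  have cell: "x \<in> ?I j \<longleftrightarrow> j = nat \<lceil>real b * x\<rceil>" if "j \<ge> 1" for j x
  proof -
    have "x \<in> ?I j \<longleftrightarrow> real j - 1 < real b * x \<and> real b * x \<le> real j"
      using assms by (simp add: field_simps)
    also have "\<dots> \<longleftrightarrow> \<lceil>real b * x\<rceil> = int j"
      by (subst ceiling_eq_iff) simp
    finally show ?thesis using that by linarith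
  qed
  \<comment> \<open>At \<open>x = 0\<close> the index is 0, which belongs to no cell, so the two
    sides may differ there; a single point is a null set.\<close>
  have "AE x in lborel. indicator {0..1} x *\<^sub>R F (nat \<lceil>real b * x\<rceil>)
          = (\<Sum>j=1..b. F j * indicator (?I j) x)"
    using AE_lborel_singleton[of 0]
  proof eventually_elim
    case (elim x)
    let ?j = "nat \<lceil>real b * x\<rceil>"
    have "(\<Sum>j=1..b. F j * indicator (?I j) x) = (\<Sum>j=1..b. if ?j = j then F j else 0)"
      by (intro sum.cong refl) (use cell in \<open>auto simp: indicator_def\<close>)
    also have "\<dots> = (if ?j \<in> {1..b} then F ?j else 0)"
      by simp
    also have "?j \<in> {1..b} \<longleftrightarrow> x \<in> {0<..1}"
    proof -
      have "1 \<le> ?j \<longleftrightarrow> 0 < x" using assms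
        by (metis One_nat_def Suc_le_eq of_nat_0_less_iff zero_less_ceiling zero_less_mult_pos zero_less_nat_eq mult_pos_pos)
      moreover have "?j \<le> b \<longleftrightarrow> x \<le> 1"
      proof -
        have "?j \<le> b \<longleftrightarrow> real b * x \<le> real b" by (simp add: nat_le_iff ceiling_le_iff)
        also have "\<dots> \<longleftrightarrow> x \<le> 1" using assms by simp
        finally show ?thesis .
      qed
      ultimately show ?thesis by auto
    qed
    finally show ?case using elim by (auto simp: indicator_def)
  qed
  then have "(LBINT x:{0..1}. F (nat \<lceil>real b * x\<rceil>))
      = (\<integral>x. (\<Sum>j=1..b. F j * indicator (?I j) x) \<partial>lborel)"
    unfolding set_lebesgue_integral_def
    by (intro integral_cong_AE) measurable
  also have "\<dots> = (\<Sum>j=1..b. F j * measure lborel (?I j))"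
    by (subst Bochner_Integration.integral_sum) (auto intro!: integrable_mult_right simp: divide_right_mono)
  also have "\<dots> = (\<Sum>j=1..b. F j) / real b"
  proof -
    have "measure lborel (?I j) = 1 / real b" for j
      using assms by (simp add: divide_right_mono diff_divide_distrib)
    then show ?thesis by (simp add: sum_divide_distrib)
  qed
  finally show ?thesis .
qed

text \<open>Dominated convergence is applied twice. The inner integral converges for almost every
  \<open>y\<close> and is at most \<open>measure lborel A * (2 * K)\<close>, which dominates the
  outer integrand.\<close>

lemma tendsto_double_set_integral_abs_diff:
  fixes f :: "real \<Rightarrow> real"
  assumes [measurable]: "A \<in> sets lborel" "f \<in> borel_measurable borel" "\<And>n. F n \<in> borel_measurable borel"
    and fin: "emeasure lborel A < \<infinity>"
    and bound: "\<And>n x. x \<in> A \<Longrightarrow> \<bar>F n x\<bar> \<le> K"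
    and conv: "AE x in lborel. x \<in> A \<longrightarrow> (\<lambda>n. F n x) \<longlonglongrightarrow> f x"
  shows "(\<lambda>n. LBINT y:A. (LBINT x:A. \<bar>F n x - F n y\<bar>))
           \<longlonglongrightarrow> (LBINT y:A. (LBINT x:A. \<bar>f x - f y\<bar>))"
proof -
  have intA: "integrable lborel (\<lambda>x. indicator A x * c)" for c :: real
    using fin assms(1) by (intro integrable_mult_left integrable_real_indicator) auto
  have dist: "\<bar>F n x - F n y\<bar> \<le> 2 * K" if "x \<in> A" "y \<in> A" for n x y
    using bound[OF that(1), of n] bound[OF that(2), of n] by linarith
  have inner: "(\<lambda>n. LBINT x:A. \<bar>F n x - F n y\<bar>) \<longlonglongrightarrow> (LBINT x:A. \<bar>f x - f y\<bar>)"
    if y: "y \<in> A" "(\<lambda>n. F n y) \<longlonglongrightarrow> f y" for y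
    unfolding set_lebesgue_integral_def
  proof (rule integral_dominated_convergence[where w = "\<lambda>x. indicator A x * (2 * K)"])
    show "AE x in lborel. (\<lambda>n. indicator A x *\<^sub>R \<bar>F n x - F n y\<bar>) \<longlonglongrightarrow> indicator A x *\<^sub>R \<bar>f x - f y\<bar>"
      using conv by eventually_elim (auto simp: indicator_def intro!: tendsto_intros y(2))
    show "AE x in lborel. norm (indicator A x *\<^sub>R \<bar>F n x - F n y\<bar>) \<le> indicator A x * (2 * K)" for n
      using dist y by (auto simp: indicator_def)
  qed (use intA in auto)
  have inner_bound: "\<bar>LBINT x:A. \<bar>F n x - F n y\<bar>\<bar> \<le> measure lborel A * (2 * K)" if y: "y \<in> A" for n y
  proof -
    have le: "norm (indicator A x *\<^sub>R \<bar>F n x - F n y\<bar>) \<le> indicator A x * (2 * K)" for x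
      using dist[OF _ y] by (simp add: indicator_def)
    have int: "integrable lborel (\<lambda>x. indicator A x *\<^sub>R \<bar>F n x - F n y\<bar>)"
      by (rule Bochner_Integration.integrable_bound[OF intA[of "2 * K"]])
        (measurable, intro AE_I2 order.trans[OF le], simp)
    have "\<bar>LBINT x:A. \<bar>F n x - F n y\<bar>\<bar> \<le> (\<integral>x. indicator A x * (2 * K) \<partial>lborel)"
      unfolding set_lebesgue_integral_def
      by (rule Bochner_Integration.integral_norm_bound_integral[OF int intA le, unfolded real_norm_def])
    also have "\<dots> = measure lborel A * (2 * K)" by simp
    finally show ?thesis .
  qed
  define G where "G n y = (LBINT x:A. \<bar>F n x - F n y\<bar>)" for n y
  define g where "g y = (LBINT x:A. \<bar>f x - f y\<bar>)" for y
  have [measurable]: "G n \<in> borel_measurable lborel" for n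
    unfolding G_def set_lebesgue_integral_def by measurable
  have [measurable]: "g \<in> borel_measurable lborel"
    unfolding g_def set_lebesgue_integral_def by measurable
  have "(\<lambda>n. LBINT y:A. G n y) \<longlonglongrightarrow> (LBINT y:A. g y)"
    unfolding set_lebesgue_integral_def
  proof (rule integral_dominated_convergence[where w = "\<lambda>x. indicator A x * (measure lborel A * (2 * K))"])
    show "AE y in lborel. (\<lambda>n. indicator A y *\<^sub>R G n y) \<longlonglongrightarrow> indicator A y *\<^sub>R g y"
      using conv by eventually_elim (auto simp: indicator_def G_def g_def intro!: inner)
    show "AE y in lborel. norm (indicator A y *\<^sub>R G n y)
        \<le> indicator A y * (measure lborel A * (2 * K))" for n
      using inner_bound by (auto simp: indicator_def G_def)
  qed (use intA in measurable)
  then show ?thesis by (simp add: G_def g_def)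
qed

subsection \<open>Local means and the statistic\<close>

lemma local_mean_add:
  "local_mean l (\<lambda>i \<omega>. X i \<omega> + Z i \<omega>) j \<omega> = local_mean l X j \<omega> + local_mean l Z j \<omega>"
  by (simp add: local_mean_def sum.distrib add_divide_distrib)

text \<open>A block with \<open>j \<ge> 1\<close> has exactly \<open>l\<close> indices, so the
  deviation of the mean from \<open>c\<close> is the mean of the deviations. For
  \<open>j = 0\<close> the block is empty and its mean is 0.\<close>

lemma abs_local_mean_diff_le:
  assumes "l > 0" "j \<ge> 1"
    and "\<And>i. (j - 1) * l < i \<Longrightarrow> i \<le> j * l \<Longrightarrow> \<bar>X i \<omega> - c\<bar> \<le> e"
  shows "\<bar>local_mean l X j \<omega> - c\<bar> \<le> e"
proof -
  define I where "I = {(j - 1) * l + 1..j * l}"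
  have card: "card I = l"
    using assms(2) by (cases j) (auto simp: I_def)
  have sum: "(\<Sum>i\<in>I. X i \<omega> - c) = (\<Sum>i\<in>I. X i \<omega>) - real l * c"
    by (simp add: sum_subtractf card)
  have "local_mean l X j \<omega> - c = (\<Sum>i\<in>I. X i \<omega> - c) / real l"
    unfolding sum using assms(1) by (simp add: local_mean_def I_def diff_divide_distrib)
  moreover have "\<bar>\<Sum>i\<in>I. X i \<omega> - c\<bar> \<le> real l * e"
  proof -
    have "\<bar>\<Sum>i\<in>I. X i \<omega> - c\<bar> \<le> (\<Sum>i\<in>I. e)"
      by (rule order.trans[OF sum_abs sum_mono]) (use assms(3) in \<open>auto simp: I_def\<close>)
    then show ?thesis by (simp add: card)
  qed
  ultimately show ?thesis
    using assms(1) by (simp add: abs_divide pos_divide_le_eq mult.commute)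
qed

lemma off_diagonal_pairs: "{(j, k). j \<in> A \<and> k \<in> A \<and> j \<noteq> k} = Sigma A (\<lambda>j. A - {j})"
  by auto

text \<open>The reverse triangle inequality changes each pair by at most
  \<open>\<bar>e j\<bar> + \<bar>e k\<bar>\<close>. Every index occurs in \<open>2 * (b - 1)\<close>
  ordered pairs, which cancels the factor \<open>b - 1\<close> of the normalisation.\<close>

lemma gini_stat_perturbation:
  assumes "b \<ge> 2"
  shows "\<bar>gini_stat l b (\<lambda>i \<omega>. X i \<omega> + Z i \<omega>) \<omega> - gini_stat l b X \<omega>\<bar>
           \<le> 2 / real b * (\<Sum>j=1..b. \<bar>local_mean l Z j \<omega>\<bar>)"
proof -
  let ?P = "{(j, k). j \<in> {1..b} \<and> k \<in> {1..b} \<and> j \<noteq> k}"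
  let ?m = "\<lambda>j. local_mean l X j \<omega>" and ?e = "\<lambda>j. local_mean l Z j \<omega>"
  let ?S = "\<Sum>j=1..b. \<bar>?e j\<bar>"
  have "(\<Sum>(j, k)\<in>?P. \<bar>?e j\<bar> + \<bar>?e k\<bar>) = (\<Sum>j=1..b. \<Sum>k\<in>{1..b} - {j}. \<bar>?e j\<bar> + \<bar>?e k\<bar>)"
    unfolding off_diagonal_pairs by (subst sum.Sigma) auto
  also have "\<dots> = (\<Sum>j=1..b. (real b - 1) * \<bar>?e j\<bar> + (?S - \<bar>?e j\<bar>))"
    by (intro sum.cong refl) (use assms in \<open>simp add: sum.distrib sum_diff1 of_nat_diff\<close>)
  also have "\<dots> = (real b - 1) * (2 * ?S)"
    by (simp add: sum.distrib sum_subtractf sum_distrib_left[symmetric] algebra_simps)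
  finally have sum: "(\<Sum>(j, k)\<in>?P. \<bar>?e j\<bar> + \<bar>?e k\<bar>) = (real b - 1) * (2 * ?S)" .
  have "\<bar>(\<Sum>(j, k)\<in>?P. \<bar>?m j + ?e j - (?m k + ?e k)\<bar>) - (\<Sum>(j, k)\<in>?P. \<bar>?m j - ?m k\<bar>)\<bar>
      \<le> (\<Sum>(j, k)\<in>?P. \<bar>?e j\<bar> + \<bar>?e k\<bar>)"
    unfolding sum_subtractf[symmetric]
    by (rule order.trans[OF sum_abs sum_mono]) (auto split: prod.splits)
  also note sum
  finally have *: "\<bar>(\<Sum>(j, k)\<in>?P. \<bar>?m j + ?e j - (?m k + ?e k)\<bar>) - (\<Sum>(j, k)\<in>?P. \<bar>?m j - ?m k\<bar>)\<bar>
      \<le> (real b - 1) * (2 * ?S)" .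
  have "\<bar>gini_stat l b (\<lambda>i \<omega>. X i \<omega> + Z i \<omega>) \<omega> - gini_stat l b X \<omega>\<bar>
      = 1 / (real b * (real b - 1)) *
        \<bar>(\<Sum>(j, k)\<in>?P. \<bar>?m j + ?e j - (?m k + ?e k)\<bar>) - (\<Sum>(j, k)\<in>?P. \<bar>?m j - ?m k\<bar>)\<bar>"
    unfolding gini_stat_def local_mean_add right_diff_distrib[symmetric] abs_mult
    using assms by simp
  also have "\<dots> \<le> 1 / (real b * (real b - 1)) * ((real b - 1) * (2 * ?S))"
    using * assms by (intro mult_left_mono) auto
  also have "\<dots> = 2 / real b * ?S"
    using assms by simp
  finally show ?thesis .
qed

text \<open>Diagonal terms vanish, so the sum runs over all pairs and equals \<open>b * b\<close>
  times the integral of a step function; dividing by \<open>b * (b - 1)\<close> leaves the stated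
  factor. At \<open>b = 1\<close> both sides are 0, since division by 0 yields 0.\<close>

lemma gini_stat_eq_integral:
  assumes "b > 0"
  shows "gini_stat l b X \<omega> = real b / (real b - 1) *
    (LBINT y:{0..1}. (LBINT x:{0..1}.
       \<bar>local_mean l X (nat \<lceil>real b * x\<rceil>) \<omega> - local_mean l X (nat \<lceil>real b * y\<rceil>) \<omega>\<bar>))"
proof -
  let ?m = "\<lambda>j. local_mean l X j \<omega>"
  have "(\<Sum>(j, k) \<in> {(j, k). j \<in> {1..b} \<and> k \<in> {1..b} \<and> j \<noteq> k}. \<bar>?m j - ?m k\<bar>)
      = (\<Sum>(j, k) \<in> {1..b} \<times> {1..b}. \<bar>?m j - ?m k\<bar>)"
    by (rule sum.mono_neutral_left) auto
  also have "\<dots> = (\<Sum>k=1..b. \<Sum>j=1..b. \<bar>?m j - ?m k\<bar>)"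
    by (subst sum.swap) (simp add: sum.cartesian_product)
  finally have sum: "(\<Sum>(j, k) \<in> {(j, k). j \<in> {1..b} \<and> k \<in> {1..b} \<and> j \<noteq> k}. \<bar>?m j - ?m k\<bar>)
      = (\<Sum>k=1..b. \<Sum>j=1..b. \<bar>?m j - ?m k\<bar>)" .
  have "(LBINT y:{0..1}. (LBINT x:{0..1}. \<bar>?m (nat \<lceil>real b * x\<rceil>) - ?m (nat \<lceil>real b * y\<rceil>)\<bar>))
      = (LBINT y:{0..1}. (\<Sum>j=1..b. \<bar>?m j - ?m (nat \<lceil>real b * y\<rceil>)\<bar>) / real b)"
    by (simp only: set_integral_step[OF assms, of "\<lambda>j. \<bar>?m j - c\<bar>" for c])
  also have "\<dots> = (\<Sum>k=1..b. (\<Sum>j=1..b. \<bar>?m j - ?m k\<bar>) / real b) / real b"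
    by (rule set_integral_step[OF assms])
  finally show ?thesis
    unfolding gini_stat_def sum using assms by (simp add: sum_divide_distrib[symmetric])
qed

text \<open>All sample points of the block lie in the unit interval, because its number is at most
  \<open>b\<close>, so their average inherits the bound of \<open>f\<close>.\<close>

lemma local_mean_sample_bound:
  assumes "l > 0" "b > 0" "x \<in> {0..1}" "\<And>x. x \<in> {0..1} \<Longrightarrow> \<bar>f x\<bar> \<le> K"
  shows "\<bar>local_mean l (\<lambda>i _. f (real i / real (l * b))) (nat \<lceil>real b * x\<rceil>) \<omega>\<bar> \<le> K"
proof (cases "nat \<lceil>real b * x\<rceil> \<ge> 1")
  case True
  let ?j = "nat \<lceil>real b * x\<rceil>"
  have "real b * x \<le> real b" using assms by (simp add: mult_left_le)
  then have "?j \<le> b" by (simp add: nat_le_iff ceiling_le_iff)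
  then have "i \<le> l * b" if "i \<le> ?j * l" for i
    using that by (metis mult.commute mult_le_mono1 order.trans)
  then have "real i / real (l * b) \<in> {0..1}" if "i \<le> ?j * l" for i
    using that assms(1,2) by (simp add: divide_le_eq_1 flip: of_nat_mult)
  then show ?thesis
    using abs_local_mean_diff_le[OF assms(1) True, of "\<lambda>i _. f (real i / real (l * b))" \<omega> 0 K] assms(4)
    by simp
next
  case False
  \<comment> \<open>This is the case \<open>x = 0\<close>: the block is empty and its mean is 0,
    which respects the bound because \<open>K\<close> is nonnegative.\<close>
  then have j: "nat \<lceil>real b * x\<rceil> = 0" by linarith
  have "0 \<le> K" using assms(4)[of 0] by simp
  then show ?thesis unfolding j by (simp add: local_mean_def)
qed

text \<open>Every sample point of the block around \<open>x\<close> is within \<open>1 / b n\<close>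
  of \<open>x\<close>, so continuity at \<open>x\<close> controls all averaged values at
  once.\<close>

lemma tendsto_local_mean_sample:
  assumes l: "\<And>n. l n > 0" and b: "\<And>n. b n > 0" "filterlim b at_top sequentially"
    and x: "x > 0" "isCont f x"
  shows "(\<lambda>n. local_mean (l n) (\<lambda>i _. f (real i / real (l n * b n))) (nat \<lceil>real (b n) * x\<rceil>) \<omega>)
           \<longlonglongrightarrow> f x"
proof (rule tendstoI)
  fix e :: real assume "e > 0"
  then obtain d where d: "d > 0" "\<And>y. dist y x < d \<Longrightarrow> dist (f y) (f x) < e / 2"
    using x(2) unfolding continuous_at_eps_delta by (metis half_gt_zero)
  have "filterlim (\<lambda>n. real (b n)) at_top sequentially"
    using b(2) by (rule filterlim_compose[OF filterlim_real_sequentially])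
  then have "\<forall>\<^sub>F n in sequentially. 1 / d < real (b n)"
    by (simp add: filterlim_at_top_dense)
  then show "\<forall>\<^sub>F n in sequentially. dist (local_mean (l n) (\<lambda>i _. f (real i / real (l n * b n)))
      (nat \<lceil>real (b n) * x\<rceil>) \<omega>) (f x) < e"
  proof eventually_elim
    case (elim n)
    let ?j = "nat \<lceil>real (b n) * x\<rceil>"
    have pos: "0 < real (b n) * x" using b(1) x(1) by simp
    then have j: "?j \<ge> 1" by linarith
    have jx: "real ?j - 1 < real (b n) * x" "real (b n) * x \<le> real ?j"
      using pos by linarith+
    have "\<bar>f (real i / real (l n * b n)) - f x\<bar> \<le> e / 2"
      if i: "(?j - 1) * l n < i" "i \<le> ?j * l n" for i
    proof -
      \<comment> \<open>Measured in block lengths, the index \<open>i\<close> and the point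
        \<open>x\<close> become \<open>u\<close> and \<open>b n * x\<close>. Both lie between
        \<open>?j - 1\<close> and \<open>?j\<close>, the lower end excluded, hence differ by less
        than 1.\<close>
      define u where "u = real i / real (l n)"
      have "real ((?j - 1) * l n) < real i" "real i \<le> real (?j * l n)"
        using i by (simp_all only: of_nat_less_iff of_nat_le_iff)
      then have "real ?j - 1 < u" "u \<le> real ?j"
        using l[of n] j by (simp_all add: u_def pos_less_divide_eq pos_divide_le_eq of_nat_diff)
      then have "\<bar>u - real (b n) * x\<bar> < 1" using jx by linarith
      moreover have "real i / real (l n * b n) - x = (u - real (b n) * x) / real (b n)"
        using l[of n] b(1)[of n] by (simp add: u_def field_simps)
      ultimately have "\<bar>real i / real (l n * b n) - x\<bar> < 1 / real (b n)"
        using b(1)[of n] by (simp add: abs_divide divide_strict_right_mono)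
      also have "\<dots> < d" using elim d(1) b(1)[of n] by (simp add: field_simps)
      finally show ?thesis
        using d(2)[of "real i / real (l n * b n)"] by (simp add: dist_real_def)
    qed
    then have "\<bar>local_mean (l n) (\<lambda>i _. f (real i / real (l n * b n))) ?j \<omega> - f x\<bar> \<le> e / 2"
      by (intro abs_local_mean_diff_le l j)
    with \<open>e > 0\<close> show ?case
      by (simp add: dist_real_def)
  qed
qed

text \<open>The step functions of local means are uniformly bounded and converge at every continuity
  point in the open interval, that is almost everywhere; the factor \<open>b / (b - 1)\<close> tends
  to 1.\<close>

lemma tendsto_gini_stat_sample:
  assumes l: "\<And>n. l n > 0" and b: "\<And>n. b n > 0" "filterlim b at_top sequentially"
    and f: "cadlag01 f"
  shows "(\<lambda>n. gini_stat (l n) (b n) (\<lambda>i _. f (real i / real (l n * b n))) \<omega>)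
           \<longlonglongrightarrow> (LBINT y:{0..1}. (LBINT x:{0..1}. \<bar>f x - f y\<bar>))"
proof -
  obtain K where K: "\<And>x. x \<in> {0..1} \<Longrightarrow> \<bar>f x\<bar> \<le> K"
    using cadlag01_bounded[OF f] by blast
  \<comment> \<open>The cut-off \<open>g\<close> is Borel measurable and has the same integrals over
    the unit interval as \<open>f\<close>.\<close>
  define g where "g x = indicator {0..1} x * f x" for x
  define F where "F n x = local_mean (l n) (\<lambda>i _. f (real i / real (l n * b n))) (nat \<lceil>real (b n) * x\<rceil>) \<omega>"
    for n x
  have "(\<lambda>n. LBINT y:{0..1}. (LBINT x:{0..1}. \<bar>F n x - F n y\<bar>))
          \<longlonglongrightarrow> (LBINT y:{0..1}. (LBINT x:{0..1}. \<bar>g x - g y\<bar>))"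
  proof (rule tendsto_double_set_integral_abs_diff)
    show "g \<in> borel_measurable borel"
      unfolding g_def by (rule cadlag01_measurable[OF f])
    show "F n \<in> borel_measurable borel" for n
      unfolding F_def by measurable
    show "\<bar>F n x\<bar> \<le> K" if "x \<in> {0..1}" for n x
      unfolding F_def by (rule local_mean_sample_bound[OF l b(1) that K])
    have "countable ({x \<in> {0<..<1}. \<not> isCont f x} \<union> {0, 1})"
      using cadlag01_countable_discont[OF f] by simp
    then have "AE x in lborel. x \<notin> {x \<in> {0<..<1}. \<not> isCont f x} \<union> {0, 1}"
      by (intro AE_not_in countable_imp_null_set_lborel)
    then show "AE x in lborel. x \<in> {0..1} \<longrightarrow> (\<lambda>n. F n x) \<longlonglongrightarrow> g x"
    proof eventually_elim
      case (elim x)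
      show ?case
      proof
        assume "x \<in> {0..1}"
        with elim have "x > 0" "isCont f x" "g x = f x" by (auto simp: g_def)
        then show "(\<lambda>n. F n x) \<longlonglongrightarrow> g x"
          unfolding F_def using tendsto_local_mean_sample[OF l b] by simp
      qed
    qed
  qed auto
  also have "(LBINT y:{0..1}. (LBINT x:{0..1}. \<bar>g x - g y\<bar>)) = (LBINT y:{0..1}. (LBINT x:{0..1}. \<bar>f x - f y\<bar>))"
    by (intro set_lebesgue_integral_cong) (auto simp: g_def intro!: set_lebesgue_integral_cong)
  finally have int: "(\<lambda>n. LBINT y:{0..1}. (LBINT x:{0..1}. \<bar>F n x - F n y\<bar>))
          \<longlonglongrightarrow> (LBINT y:{0..1}. (LBINT x:{0..1}. \<bar>f x - f y\<bar>))" .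
  have "filterlim (\<lambda>x::real. x - 1) at_top at_top"
    using filterlim_tendsto_add_at_top[OF tendsto_const[of "-1"] filterlim_ident] by simp
  then have "((\<lambda>x::real. 1 + inverse (x - 1)) \<longlongrightarrow> 1 + 0) at_top"
    by (intro tendsto_add tendsto_const tendsto_inverse_0_at_top)
  moreover have "\<forall>\<^sub>F x::real in at_top. 1 + inverse (x - 1) = x / (x - 1)"
    using eventually_gt_at_top[of 1] by eventually_elim (simp add: field_simps)
  ultimately have "((\<lambda>x::real. x / (x - 1)) \<longlongrightarrow> 1) at_top"
    using Lim_transform_eventually by fastforce
  then have "(\<lambda>n. real (b n) / (real (b n) - 1)) \<longlonglongrightarrow> 1"
    by (rule filterlim_compose) (rule filterlim_compose[OF filterlim_real_sequentially b(2)])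
  from tendsto_mult[OF this int] show ?thesis
    by (simp add: gini_stat_eq_integral[OF b(1)] F_def)
qed

subsection \<open>Stationarity and mixing\<close>

text \<open>Stationarity speaks of the initial segments \<open>{1..m}\<close>. With
  \<open>m = max i j\<close>, the pair is a coordinate projection of the shifted segment.\<close>

lemma strictly_stationary_distr_pair:
  assumes "strictly_stationary M Y" "i \<ge> 1" "j \<ge> 1"
  shows "distr M (borel \<Otimes>\<^sub>M borel) (\<lambda>\<omega>. (Y (i + h) \<omega>, Y (j + h) \<omega>))
       = distr M (borel \<Otimes>\<^sub>M borel) (\<lambda>\<omega>. (Y i \<omega>, Y j \<omega>))"
proof -
  define m where "m = max i j"
  let ?P = "Pi\<^sub>M {1..m} (\<lambda>_. borel :: real measure)"
  have Y[measurable]: "Y k \<in> borel_measurable M" if "k \<ge> 1" for k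
    using assms(1) that by (auto simp: strictly_stationary_def)
  have proj: "(\<lambda>x. (x i, x j)) \<in> ?P \<rightarrow>\<^sub>M borel \<Otimes>\<^sub>M borel"
    using assms(2,3) by (intro measurable_Pair measurable_component_singleton) (auto simp: m_def)
  have tuple: "(\<lambda>\<omega>. \<lambda>k\<in>{1..m}. Y (k + h) \<omega>) \<in> M \<rightarrow>\<^sub>M ?P" for h
    by (intro measurable_restrict) auto
  have comp: "distr M (borel \<Otimes>\<^sub>M borel) (\<lambda>\<omega>. (Y (i + h) \<omega>, Y (j + h) \<omega>))
      = distr (distr M ?P (\<lambda>\<omega>. \<lambda>k\<in>{1..m}. Y (k + h) \<omega>)) (borel \<Otimes>\<^sub>M borel) (\<lambda>x. (x i, x j))" for h
    by (subst distr_distr[OF proj tuple], intro distr_cong refl)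
      (use assms(2,3) in \<open>auto simp: m_def\<close>)
  have "m \<ge> 1" using assms(2) by (simp add: m_def)
  then have "distr M ?P (\<lambda>\<omega>. \<lambda>k\<in>{1..m}. Y (k + h) \<omega>) = distr M ?P (\<lambda>\<omega>. \<lambda>k\<in>{1..m}. Y (k + 0) \<omega>)"
    using assms(1) by (simp add: strictly_stationary_def)
  then show ?thesis using comp[of h] comp[of 0] by simp
qed

lemma
  fixes f :: "real \<times> real \<Rightarrow> real"
  assumes stat: "strictly_stationary M Y" and "i \<ge> 1" "j \<ge> 1"
    and f: "f \<in> borel_measurable (borel \<Otimes>\<^sub>M borel)"
  shows strictly_stationary_integrable_pair:
      "integrable M (\<lambda>\<omega>. f (Y (i + h) \<omega>, Y (j + h) \<omega>)) \<longleftrightarrow> integrable M (\<lambda>\<omega>. f (Y i \<omega>, Y j \<omega>))"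
    and strictly_stationary_integral_pair:
      "(\<integral>\<omega>. f (Y (i + h) \<omega>, Y (j + h) \<omega>) \<partial>M) = (\<integral>\<omega>. f (Y i \<omega>, Y j \<omega>) \<partial>M)"
proof -
  have Y[measurable]: "Y k \<in> borel_measurable M" if "k \<ge> 1" for k
    using assms(1) that by (auto simp: strictly_stationary_def)
  have pair: "(\<lambda>\<omega>. (Y (i + h) \<omega>, Y (j + h) \<omega>)) \<in> M \<rightarrow>\<^sub>M borel \<Otimes>\<^sub>M borel" for h
    using assms(2,3) by (intro measurable_Pair) auto
  note eq = strictly_stationary_distr_pair[OF assms(1-3), of h]
  show "integrable M (\<lambda>\<omega>. f (Y (i + h) \<omega>, Y (j + h) \<omega>)) \<longleftrightarrow> integrable M (\<lambda>\<omega>. f (Y i \<omega>, Y j \<omega>))"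
    using integrable_distr_eq[OF pair f, of h] integrable_distr_eq[OF pair f, of 0] eq by simp
  show "(\<integral>\<omega>. f (Y (i + h) \<omega>, Y (j + h) \<omega>) \<partial>M) = (\<integral>\<omega>. f (Y i \<omega>, Y j \<omega>) \<partial>M)"
    using integral_distr[OF pair f, of h] integral_distr[OF pair f, of 0] eq by simp
qed

text \<open>A single variable is treated as the first component of the pair with both indices 1,
  shifted by \<open>i - 1\<close>.\<close>

lemma
  assumes "strictly_stationary M Y" "i \<ge> 1" and f: "f \<in> borel_measurable borel"
  shows strictly_stationary_integrable:
      "integrable M (\<lambda>\<omega>. f (Y i \<omega>) :: real) \<longleftrightarrow> integrable M (\<lambda>\<omega>. f (Y 1 \<omega>))"
    and strictly_stationary_integral:
      "(\<integral>\<omega>. f (Y i \<omega>) \<partial>M) = (\<integral>\<omega>. f (Y 1 \<omega>) \<partial>M)"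
proof -
  have m: "(\<lambda>p. f (fst p)) \<in> borel_measurable (borel \<Otimes>\<^sub>M borel :: (real \<times> real) measure)"
    using f by measurable
  have i: "1 + (i - 1) = i" using assms(2) by simp
  show "integrable M (\<lambda>\<omega>. f (Y i \<omega>)) \<longleftrightarrow> integrable M (\<lambda>\<omega>. f (Y 1 \<omega>))"
    using strictly_stationary_integrable_pair[OF assms(1) order_refl order_refl m, of "i - 1"]
    unfolding i by simp
  show "(\<integral>\<omega>. f (Y i \<omega>) \<partial>M) = (\<integral>\<omega>. f (Y 1 \<omega>) \<partial>M)"
    using strictly_stationary_integral_pair[OF assms(1) order_refl order_refl m, of "i - 1"]
    unfolding i by simp
qed

text \<open>Shifting the index pair \<open>(1, Suc (j - i))\<close> by \<open>i - 1\<close> gives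
  \<open>(i, j)\<close>, so product moments depend on the lag alone.\<close>

lemma strictly_stationary_product_moment:
  assumes "strictly_stationary M Y" "1 \<le> i" "i \<le> j"
  shows "(\<integral>\<omega>. Y i \<omega> * Y j \<omega> \<partial>M) = (\<integral>\<omega>. Y 1 \<omega> * Y (Suc (j - i)) \<omega> \<partial>M)"
proof -
  have m: "(\<lambda>p. fst p * snd p) \<in> borel_measurable (borel \<Otimes>\<^sub>M borel :: (real \<times> real) measure)"
    by measurable
  have "1 + (i - 1) = i" "Suc (j - i) + (i - 1) = j" using assms(2,3) by simp_all
  then show ?thesis
    using strictly_stationary_integral_pair[OF assms(1) order_refl _ m, of "Suc (j - i)" "i - 1"]
    by simp
qed

section \<open>Mixing coefficients and bounds for product moments\<close>

context prob_space
begin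

text \<open>Keeps the suprema in \<open>alpha_coeff\<close> and \<open>alpha_mix\<close> bounded, so
  that they really are upper bounds of their families.\<close>

lemma abs_prob_diff_le_1: "\<bar>prob A * prob B - prob (A \<inter> B)\<bar> \<le> 1"
proof -
  have "0 \<le> prob A * prob B" "prob A * prob B \<le> 1"
    by (intro mult_nonneg_nonneg mult_le_one measure_nonneg prob_le_1)+
  moreover have "0 \<le> prob (A \<inter> B)" "prob (A \<inter> B) \<le> 1"
    by (rule measure_nonneg prob_le_1)+
  ultimately show ?thesis by linarith
qed

lemma alpha_coeff_upper:
  assumes "A \<in> \<A>" "B \<in> \<B>"
  shows "\<bar>prob A * prob B - prob (A \<inter> B)\<bar> \<le> alpha_coeff M \<A> \<B>"
  unfolding alpha_coeff_def
  by (rule cSUP_upper2[where x = "(A, B)"])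
    (use assms abs_prob_diff_le_1 in \<open>auto intro!: bdd_aboveI2[where M = 1]\<close>)

lemma alpha_coeff_le_1:
  assumes "\<A> \<noteq> {}" "\<B> \<noteq> {}"
  shows "alpha_coeff M \<A> \<B> \<le> 1"
  unfolding alpha_coeff_def
  by (rule cSUP_least) (use assms abs_prob_diff_le_1 in auto)

lemma alpha_mix_upper:
  assumes "A \<in> sigma_gen M Y {1..m}" "B \<in> sigma_gen M Y {k + m..}" "m \<ge> 1"
  shows "\<bar>prob A * prob B - prob (A \<inter> B)\<bar> \<le> alpha_mix M Y k"
proof -
  have ne: "sigma_gen M Y I \<noteq> {}" for I
    unfolding sigma_gen_def using sigma_sets.Empty by blast
  have "alpha_coeff M (sigma_gen M Y {1..m}) (sigma_gen M Y {k + m..}) \<le> alpha_mix M Y k"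
    unfolding alpha_mix_def
    by (rule cSUP_upper) (use assms(3) alpha_coeff_le_1[OF ne ne] in \<open>auto intro!: bdd_aboveI2[where M = 1]\<close>)
  with alpha_coeff_upper[OF assms(1,2)] show ?thesis by linarith
qed

text \<open>Expanding both variables over their level sets turns the covariance into a finite sum of
  terms \<open>u * v\<close> times a dependence defect of two events, each defect being at most
  \<open>a\<close> in absolute value.\<close>

lemma finite_range_covariance_bound:
  fixes X Z :: "'a \<Rightarrow> real"
  assumes [measurable]: "X \<in> borel_measurable M" "Z \<in> borel_measurable M"
    and R: "finite R" "\<And>\<omega>. X \<omega> \<in> R" "\<And>\<omega>. Z \<omega> \<in> R"
    and dep: "\<And>u v. \<bar>prob (X -` {u} \<inter> space M) * prob (Z -` {v} \<inter> space M)
                - prob (X -` {u} \<inter> space M \<inter> (Z -` {v} \<inter> space M))\<bar> \<le> a"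
  shows "\<bar>expectation (\<lambda>\<omega>. X \<omega> * Z \<omega>) - expectation X * expectation Z\<bar> \<le> (\<Sum>u\<in>R. \<bar>u\<bar>)\<^sup>2 * a"
proof -
  define A where "A u = X -` {u} \<inter> space M" for u
  define B where "B v = Z -` {v} \<inter> space M" for v
  have [measurable]: "A u \<in> events" "B u \<in> events" for u
    by (simp_all add: A_def B_def)
  have X: "X \<omega> = (\<Sum>u\<in>R. u * indicator (A u) \<omega>)" if "\<omega> \<in> space M" for \<omega>
  proof -
    have "(\<Sum>u\<in>R. u * indicator (A u) \<omega>) = (\<Sum>u\<in>R. if X \<omega> = u then u else 0)"
      using that by (intro sum.cong) (auto simp: A_def)
    then show ?thesis using R by simp
  qed
  have Z: "Z \<omega> = (\<Sum>v\<in>R. v * indicator (B v) \<omega>)" if "\<omega> \<in> space M" for \<omega>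
  proof -
    have "(\<Sum>v\<in>R. v * indicator (B v) \<omega>) = (\<Sum>v\<in>R. if Z \<omega> = v then v else 0)"
      using that by (intro sum.cong) (auto simp: B_def)
    then show ?thesis using R by simp
  qed
  have EX: "expectation X = (\<Sum>u\<in>R. u * prob (A u))"
    by (subst Bochner_Integration.integral_cong[OF refl X], assumption)
      (subst Bochner_Integration.integral_sum; auto intro!: integrable_real_indicator simp: emeasure_eq_measure)
  have EZ: "expectation Z = (\<Sum>v\<in>R. v * prob (B v))"
    by (subst Bochner_Integration.integral_cong[OF refl Z], assumption)
      (subst Bochner_Integration.integral_sum; auto intro!: integrable_real_indicator simp: emeasure_eq_measure)
  have XZ: "X \<omega> * Z \<omega> = (\<Sum>u\<in>R. \<Sum>v\<in>R. u * v * indicator (A u \<inter> B v) \<omega>)" if "\<omega> \<in> space M" for \<omega>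
    unfolding X[OF that] Z[OF that] sum_product
    by (intro sum.cong refl) (simp add: indicator_inter_arith)
  have EXZ: "expectation (\<lambda>\<omega>. X \<omega> * Z \<omega>) = (\<Sum>u\<in>R. \<Sum>v\<in>R. u * v * prob (A u \<inter> B v))"
  proof -
    have int: "integrable M (\<lambda>\<omega>. u * v * indicator (A u \<inter> B v) \<omega>)" for u v :: real
      by (auto intro!: integrable_real_indicator simp: emeasure_eq_measure)
    have "expectation (\<lambda>\<omega>. X \<omega> * Z \<omega>) = expectation (\<lambda>\<omega>. \<Sum>u\<in>R. \<Sum>v\<in>R. u * v * indicator (A u \<inter> B v) \<omega>)"
      by (intro Bochner_Integration.integral_cong refl XZ)
    also have "\<dots> = (\<Sum>u\<in>R. \<Sum>v\<in>R. expectation (\<lambda>\<omega>. u * v * indicator (A u \<inter> B v) \<omega>))"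
      by (simp only: Bochner_Integration.integral_sum int Bochner_Integration.integrable_sum)
    also have "\<dots> = (\<Sum>u\<in>R. \<Sum>v\<in>R. u * v * prob (A u \<inter> B v))"
      by simp
    finally show ?thesis .
  qed
  have "expectation (\<lambda>\<omega>. X \<omega> * Z \<omega>) - expectation X * expectation Z
      = (\<Sum>u\<in>R. \<Sum>v\<in>R. u * v * (prob (A u \<inter> B v) - prob (A u) * prob (B v)))"
    unfolding EXZ EX EZ sum_product sum_subtractf[symmetric]
    by (intro sum.cong refl) (simp add: algebra_simps)
  also have "\<bar>\<dots>\<bar> \<le> (\<Sum>u\<in>R. \<Sum>v\<in>R. \<bar>u\<bar> * \<bar>v\<bar> * a)"
  proof (intro order.trans[OF sum_abs] sum_mono)
    fix u v
    show "\<bar>u * v * (prob (A u \<inter> B v) - prob (A u) * prob (B v))\<bar> \<le> \<bar>u\<bar> * \<bar>v\<bar> * a"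
      unfolding abs_mult using dep[of u v]
      by (intro mult_left_mono) (auto simp: A_def B_def abs_minus_commute)
  qed
  also have "\<dots> = (\<Sum>u\<in>R. \<bar>u\<bar>)\<^sup>2 * a"
    unfolding power2_eq_square sum_product by (simp only: sum_distrib_right)
  finally show ?thesis .
qed

lemma integrable_product_of_squares:
  fixes X Z :: "'a \<Rightarrow> real"
  assumes [measurable]: "X \<in> borel_measurable M" "Z \<in> borel_measurable M"
    and "integrable M (\<lambda>\<omega>. (X \<omega>)\<^sup>2)" "integrable M (\<lambda>\<omega>. (Z \<omega>)\<^sup>2)"
  shows "integrable M (\<lambda>\<omega>. X \<omega> * Z \<omega>)"
proof (rule Bochner_Integration.integrable_bound[OF Bochner_Integration.integrable_add[OF assms(3,4)]])
  have "\<bar>x * z\<bar> \<le> x\<^sup>2 + z\<^sup>2" for x z :: real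
  proof -
    have "2 * \<bar>x * z\<bar> \<le> x\<^sup>2 + z\<^sup>2"
      using sum_squares_bound[of "\<bar>x\<bar>" "\<bar>z\<bar>"] by (simp add: abs_mult mult.assoc)
    then show ?thesis by linarith
  qed
  then show "AE \<omega> in M. norm (X \<omega> * Z \<omega>) \<le> norm ((X \<omega>)\<^sup>2 + (Z \<omega>)\<^sup>2)"
    by (intro AE_I2) simp
qed measurable

text \<open>A Cauchy-Schwarz bound without roots: in
  \<open>\<bar>x * z\<bar> \<le> (x\<^sup>2 / t + t * z\<^sup>2) / 2\<close> the weight
  \<open>t\<close> is chosen so that both summands have expectation at most
  \<open>t * q\<close>.\<close>

lemma abs_expectation_product_le:
  fixes X Z :: "'a \<Rightarrow> real"
  assumes [measurable]: "X \<in> borel_measurable M" "Z \<in> borel_measurable M"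
    and "integrable M (\<lambda>\<omega>. (X \<omega>)\<^sup>2)" "integrable M (\<lambda>\<omega>. (Z \<omega>)\<^sup>2)"
    and "t > 0" "expectation (\<lambda>\<omega>. (X \<omega>)\<^sup>2) \<le> t\<^sup>2 * q" "expectation (\<lambda>\<omega>. (Z \<omega>)\<^sup>2) \<le> q"
  shows "\<bar>expectation (\<lambda>\<omega>. X \<omega> * Z \<omega>)\<bar> \<le> t * q"
proof -
  have am: "\<bar>x * z\<bar> \<le> (x\<^sup>2 / t + t * z\<^sup>2) / 2" for x z :: real
    using sum_squares_bound[of "\<bar>x\<bar>" "t * \<bar>z\<bar>"] assms(5)
    by (simp add: abs_mult field_simps power2_eq_square)
  have "\<bar>expectation (\<lambda>\<omega>. X \<omega> * Z \<omega>)\<bar> \<le> expectation (\<lambda>\<omega>. ((X \<omega>)\<^sup>2 / t + t * (Z \<omega>)\<^sup>2) / 2)"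
    using am assms(3,4) integrable_product_of_squares[OF assms(1-4)]
    by (intro order.trans[OF integral_abs_bound] integral_mono) simp_all
  also have "\<dots> = (expectation (\<lambda>\<omega>. (X \<omega>)\<^sup>2) / t + t * expectation (\<lambda>\<omega>. (Z \<omega>)\<^sup>2)) / 2"
    using assms by simp
  also have "\<dots> \<le> (t\<^sup>2 * q / t + t * q) / 2"
    using assms by (intro divide_right_mono add_mono mult_left_mono) auto
  also have "\<dots> = t * q"
    using assms(5) by (simp add: power2_eq_square)
  finally show ?thesis .
qed

end

section \<open>Cesaro means, sums over lags and approximation by simple functions\<close>

lemma cesaro_tendsto_0:
  fixes c :: "nat \<Rightarrow> real"
  assumes c: "c \<longlonglongrightarrow> 0" and nonneg: "\<And>k. 0 \<le> c k"
  shows "(\<lambda>n. (\<Sum>k<n. c k) / real n) \<longlonglongrightarrow> 0"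
proof (rule tendstoI)
  fix e :: real assume "e > 0"
  then have "\<forall>\<^sub>F k in sequentially. c k < e / 2"
    using order_tendstoD(2)[OF c, of "e / 2"] by simp
  then obtain N where N: "\<And>k. k \<ge> N \<Longrightarrow> c k < e / 2"
    by (auto simp: eventually_sequentially)
  define C where "C = (\<Sum>k<N. c k)"
  have "(\<lambda>n. C / real n) \<longlonglongrightarrow> 0"
    by (rule lim_const_over_n)
  then have "\<forall>\<^sub>F n in sequentially. C / real n < e / 2"
    using order_tendstoD(2) \<open>e > 0\<close> by (metis half_gt_zero)
  then show "\<forall>\<^sub>F n in sequentially. dist ((\<Sum>k<n. c k) / real n) 0 < e"
    using eventually_gt_at_top[of 0]
  proof eventually_elim
    case (elim n)
    have "(\<Sum>k<n. c k) \<le> (\<Sum>k\<in>{..<N} \<union> {N..<n}. c k)"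
      by (rule sum_mono2) (use nonneg in auto)
    also have "\<dots> = C + (\<Sum>k\<in>{N..<n}. c k)"
      unfolding C_def by (rule sum.union_disjoint) auto
    also have "(\<Sum>k\<in>{N..<n}. c k) \<le> (\<Sum>k\<in>{N..<n}. e / 2)"
      by (rule sum_mono) (use N less_imp_le in auto)
    also have "\<dots> \<le> real n * (e / 2)"
      using \<open>e > 0\<close> by (simp add: mult_right_mono)
    finally have "(\<Sum>k<n. c k) \<le> C + real n * (e / 2)" by simp
    then have "(\<Sum>k<n. c k) / real n \<le> C / real n + e / 2"
      using elim by (simp add: field_simps)
    then have "(\<Sum>k<n. c k) / real n < e" using elim by linarith
    moreover have "0 \<le> (\<Sum>k<n. c k) / real n"
      by (intro divide_nonneg_nonneg sum_nonneg nonneg) simp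
    ultimately show ?case by simp
  qed
qed

text \<open>For fixed \<open>i\<close>, each lag below \<open>l\<close> occurs at most once on
  either side of \<open>i\<close>. The conditional expresses the distance of \<open>i\<close> and
  \<open>j\<close> without truncated subtraction.\<close>

lemma sum_lag_le:
  fixes c :: "nat \<Rightarrow> real"
  assumes "\<And>k. 0 \<le> c k" "i \<in> {a + 1..a + l}"
  shows "(\<Sum>j\<in>{a + 1..a + l}. c (if i \<le> j then j - i else i - j)) \<le> 2 * (\<Sum>k<l. c k)"
proof -
  let ?I = "{a + 1..a + l}"
  have "(\<Sum>j\<in>?I. c (if i \<le> j then j - i else i - j))
      = (\<Sum>j\<in>?I \<inter> {j. i \<le> j}. c (j - i)) + (\<Sum>j\<in>?I \<inter> - {j. i \<le> j}. c (i - j))"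
    by (simp add: if_distrib[of c] sum.If_cases)
  also have "(\<Sum>j\<in>?I \<inter> {j. i \<le> j}. c (j - i)) = (\<Sum>k\<in>(\<lambda>j. j - i) ` (?I \<inter> {j. i \<le> j}). c k)"
    by (subst sum.reindex) (auto simp: inj_on_def)
  also have "\<dots> \<le> (\<Sum>k<l. c k)"
    by (rule sum_mono2) (use assms in auto)
  also have "(\<Sum>j\<in>?I \<inter> - {j. i \<le> j}. c (i - j)) = (\<Sum>k\<in>(\<lambda>j. i - j) ` (?I \<inter> - {j. i \<le> j}). c k)"
    by (subst sum.reindex) (auto simp: inj_on_def)
  also have "\<dots> \<le> (\<Sum>k<l. c k)"
    by (rule sum_mono2) (use assms in auto)
  finally show ?thesis by simp
qed

text \<open>Simple functions approximate the identity on the reals rather than \<open>X\<close>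
  itself, so the same \<open>s\<close> can be applied to every variable with the law of
  \<open>X\<close>. The bound \<open>2 * \<bar>x\<bar>\<close> gives the dominating function
  \<open>9 * (X \<omega>)\<^sup>2\<close>.\<close>

lemma simple_function_approx_identity_L2:
  assumes X: "X \<in> borel_measurable M" and sq: "integrable M (\<lambda>\<omega>. (X \<omega> :: real)\<^sup>2)" and "e > 0"
  obtains s where "simple_function borel s" "\<And>x. \<bar>s x\<bar> \<le> 2 * \<bar>x\<bar>"
    "(\<integral>\<omega>. (X \<omega> - s (X \<omega>))\<^sup>2 \<partial>M) < e"
proof -
  obtain F :: "nat \<Rightarrow> real \<Rightarrow> real" where F: "\<And>i. simple_function borel (F i)"
    "\<And>x. (\<lambda>i. F i x) \<longlonglongrightarrow> x" "\<And>i x. dist (F i x) 0 \<le> 2 * dist x 0"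
    using borel_measurable_implies_sequence_metric[of "\<lambda>x. x" borel "0::real"] by auto
  have [measurable]: "F i \<in> borel_measurable borel" for i
    using F(1) by (rule borel_measurable_simple_function)
  note [measurable] = X
  have "(\<lambda>i. \<integral>\<omega>. (X \<omega> - F i (X \<omega>))\<^sup>2 \<partial>M) \<longlonglongrightarrow> (\<integral>\<omega>. 0 \<partial>M)"
  proof (rule integral_dominated_convergence[where w = "\<lambda>\<omega>. 9 * (X \<omega>)\<^sup>2"])
    have "(\<lambda>i. (x - F i x)\<^sup>2) \<longlonglongrightarrow> (x - x)\<^sup>2" for x
      by (intro tendsto_intros F)
    then show "AE \<omega> in M. (\<lambda>i. (X \<omega> - F i (X \<omega>))\<^sup>2) \<longlonglongrightarrow> 0"
      by (intro AE_I2) simp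
    have "(x - F i x)\<^sup>2 \<le> 9 * x\<^sup>2" for i x
    proof -
      have "\<bar>x - F i x\<bar> \<le> \<bar>3 * x\<bar>" using F(3)[of i x] by (simp add: dist_real_def)
      then have "(x - F i x)\<^sup>2 \<le> (3 * x)\<^sup>2" by (simp only: abs_le_square_iff)
      then show ?thesis by (simp add: power_mult_distrib)
    qed
    then show "AE \<omega> in M. norm ((X \<omega> - F i (X \<omega>))\<^sup>2) \<le> 9 * (X \<omega>)\<^sup>2" for i
      by (intro AE_I2) simp
  qed (use sq in simp_all)
  then have "\<forall>\<^sub>F i in sequentially. (\<integral>\<omega>. (X \<omega> - F i (X \<omega>))\<^sup>2 \<partial>M) < e"
    using order_tendstoD(2) \<open>e > 0\<close> by fastforce
  then obtain i where "(\<integral>\<omega>. (X \<omega> - F i (X \<omega>))\<^sup>2 \<partial>M) < e"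
    by (auto simp: eventually_sequentially)
  with F show thesis by (intro that[of "F i"]) auto
qed

section \<open>Decay of the covariances and second moments of weighted sums\<close>

context prob_space
begin

text \<open>With \<open>X = Y 1\<close> and \<open>Z = Y (Suc k)\<close>, the product splits into
  \<open>(X - s X) * Z\<close>, \<open>(Z - s Z) * s X\<close> and \<open>s X * s Z\<close>. The
  first two are small by approximation. The third is a covariance controlled by mixing plus a
  product of means, small because \<open>Y 1\<close> is centred.\<close>

lemma mixing_product_moment_tendsto_0:
  assumes stat: "strictly_stationary M Y" and mix: "alpha_mixing M Y"
    and mean: "expectation (Y 1) = 0" and sq: "integrable M (\<lambda>\<omega>. (Y 1 \<omega>)\<^sup>2)"
  shows "(\<lambda>k. expectation (\<lambda>\<omega>. Y 1 \<omega> * Y (Suc k) \<omega>)) \<longlonglongrightarrow> 0"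
proof (rule tendstoI)
  fix e :: real assume "e > 0"
  \<comment> \<open>A common bound for the second moments of \<open>Y 1\<close> and
    \<open>s (Y 1)\<close>, the 4 coming from
    \<open>\<bar>s x\<bar> \<le> 2 * \<bar>x\<bar>\<close>; the added 1 allows division by
    \<open>q\<close>.\<close>
  define q where "q = 4 * expectation (\<lambda>\<omega>. (Y 1 \<omega>)\<^sup>2) + 1"
  have v: "expectation (\<lambda>\<omega>. (Y 1 \<omega>)\<^sup>2) \<ge> 0" by simp
  then have q: "q \<ge> 1" by (simp add: q_def)
  \<comment> \<open>Two approximation errors and the product of means cost at most \<open>r\<close>
    each, together at most \<open>e / 2\<close>; the other half is left to the mixing term. The cap
    at 1 gives \<open>r * r \<le> r\<close>.\<close>
  define r where "r = min 1 (e / 6)"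
  have r: "r > 0" "r \<le> 1" "r \<le> e / 6" using \<open>e > 0\<close> by (auto simp: r_def)
  define t where "t = r / q"
  have t: "t > 0" "t * q = r" using r q by (auto simp: t_def)
  have [measurable]: "Y k \<in> borel_measurable M" if "k \<ge> 1" for k
    using stat that by (auto simp: strictly_stationary_def)
  have "t\<^sup>2 * q > 0" using t q by simp
  then obtain s where s: "simple_function borel s" "\<And>x. \<bar>s x\<bar> \<le> 2 * \<bar>x\<bar>"
    "expectation (\<lambda>\<omega>. (Y 1 \<omega> - s (Y 1 \<omega>))\<^sup>2) < t\<^sup>2 * q"
    using simple_function_approx_identity_L2[OF _ sq, of "t\<^sup>2 * q"] by auto
  have [measurable]: "s \<in> borel_measurable borel"
    using s(1) by (rule borel_measurable_simple_function)
  have s2: "(s x)\<^sup>2 \<le> 4 * x\<^sup>2" "(x - s x)\<^sup>2 \<le> 9 * x\<^sup>2" for x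
  proof -
    have "\<bar>s x\<bar> \<le> \<bar>2 * x\<bar>" "\<bar>x - s x\<bar> \<le> \<bar>3 * x\<bar>" using s(2)[of x] by linarith+
    then have "(s x)\<^sup>2 \<le> (2 * x)\<^sup>2" "(x - s x)\<^sup>2 \<le> (3 * x)\<^sup>2" by (simp_all only: abs_le_square_iff)
    then show "(s x)\<^sup>2 \<le> 4 * x\<^sup>2" "(x - s x)\<^sup>2 \<le> 9 * x\<^sup>2" by (simp_all add: power_mult_distrib)
  qed
  have int1: "integrable M (\<lambda>\<omega>. (s (Y 1 \<omega>))\<^sup>2)"
    by (rule Bochner_Integration.integrable_bound[OF integrable_mult_right[OF sq, of 4]])
      (use s2 in auto)
  have int2: "integrable M (\<lambda>\<omega>. (Y 1 \<omega> - s (Y 1 \<omega>))\<^sup>2)"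
    by (rule Bochner_Integration.integrable_bound[OF integrable_mult_right[OF sq, of 9]])
      (use s2 in auto)
  have Es: "expectation (\<lambda>\<omega>. (s (Y 1 \<omega>))\<^sup>2) \<le> q"
  proof -
    have "expectation (\<lambda>\<omega>. (s (Y 1 \<omega>))\<^sup>2) \<le> expectation (\<lambda>\<omega>. 4 * (Y 1 \<omega>)\<^sup>2)"
      using int1 sq s2 by (intro integral_mono) auto
    then show ?thesis by (simp add: q_def)
  qed
  have int3: "integrable M (\<lambda>\<omega>. s (Y 1 \<omega>))"
    using integrable_product_of_squares[of "\<lambda>_. 1" "\<lambda>\<omega>. s (Y 1 \<omega>)"] int1 by simp
  have int4: "integrable M (Y 1)"
    using integrable_product_of_squares[of "\<lambda>_. 1" "Y 1"] sq by simp
  have mean_s: "\<bar>expectation (\<lambda>\<omega>. s (Y 1 \<omega>))\<bar> \<le> r"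
  proof -
    \<comment> \<open>Taking the constant 1 as second factor, with second moment
      \<open>1 \<le> q\<close>, bounds the mean of the approximation error, which is minus the mean
      of \<open>s (Y 1)\<close>.\<close>
    have "\<bar>expectation (\<lambda>\<omega>. (Y 1 \<omega> - s (Y 1 \<omega>)) * 1)\<bar> \<le> t * q"
      by (rule abs_expectation_product_le) (use int2 s(3) t q prob_space in auto)
    then show ?thesis using int3 int4 mean t by simp
  qed
  define R where "R = range s"
  have R: "finite R" using simple_functionD(1)[OF s(1)] by (simp add: R_def)
  have "(\<lambda>k. (\<Sum>u\<in>R. \<bar>u\<bar>)\<^sup>2 * alpha_mix M Y k) \<longlonglongrightarrow> (\<Sum>u\<in>R. \<bar>u\<bar>)\<^sup>2 * 0"
    using mix unfolding alpha_mixing_def by (intro tendsto_intros)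
  then have "\<forall>\<^sub>F k in sequentially. (\<Sum>u\<in>R. \<bar>u\<bar>)\<^sup>2 * alpha_mix M Y k < e / 2"
    using order_tendstoD(2)[of _ 0 _ "e / 2"] \<open>e > 0\<close> by simp
  then show "\<forall>\<^sub>F k in sequentially. dist (expectation (\<lambda>\<omega>. Y 1 \<omega> * Y (Suc k) \<omega>)) 0 < e"
  proof eventually_elim
    case (elim k)
    define X where "X = Y 1"
    define Z where "Z = Y (Suc k)"
    have [measurable]: "X \<in> borel_measurable M" "Z \<in> borel_measurable M"
      by (simp_all add: X_def Z_def)
    have trI: "integrable M (\<lambda>\<omega>. f (Z \<omega>)) \<longleftrightarrow> integrable M (\<lambda>\<omega>. f (X \<omega>))"
      and tr: "expectation (\<lambda>\<omega>. f (Z \<omega>)) = expectation (\<lambda>\<omega>. f (X \<omega>))"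
      if "f \<in> borel_measurable borel" for f :: "real \<Rightarrow> real"
      unfolding X_def Z_def
      using strictly_stationary_integrable[OF stat _ that, of "Suc k"]
        strictly_stationary_integral[OF stat _ that, of "Suc k"] by simp_all
    have iZ: "integrable M (\<lambda>\<omega>. (Z \<omega>)\<^sup>2)" "integrable M (\<lambda>\<omega>. (s (Z \<omega>))\<^sup>2)"
        "integrable M (\<lambda>\<omega>. (Z \<omega> - s (Z \<omega>))\<^sup>2)"
      using trI[of "\<lambda>x. x\<^sup>2"] trI[of "\<lambda>x. (s x)\<^sup>2"] trI[of "\<lambda>x. (x - s x)\<^sup>2"] sq int1 int2
      by (simp_all add: X_def)
    have eZ: "expectation (\<lambda>\<omega>. (Z \<omega>)\<^sup>2) \<le> q" "expectation (\<lambda>\<omega>. (Z \<omega> - s (Z \<omega>))\<^sup>2) < t\<^sup>2 * q"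
        "expectation (\<lambda>\<omega>. s (Z \<omega>)) = expectation (\<lambda>\<omega>. s (X \<omega>))"
      using tr[of "\<lambda>x. x\<^sup>2"] tr[of s] tr[of "\<lambda>x. (x - s x)\<^sup>2"] s(3) v
      by (simp_all add: X_def q_def)
    have iX: "integrable M (\<lambda>\<omega>. (X \<omega>)\<^sup>2)" "integrable M (\<lambda>\<omega>. (s (X \<omega>))\<^sup>2)"
        "integrable M (\<lambda>\<omega>. (X \<omega> - s (X \<omega>))\<^sup>2)"
      using sq int1 int2 by (simp_all add: X_def)
    have "expectation (\<lambda>\<omega>. X \<omega> * Z \<omega>) = expectation (\<lambda>\<omega>. (X \<omega> - s (X \<omega>)) * Z \<omega>
        + (Z \<omega> - s (Z \<omega>)) * s (X \<omega>) + s (X \<omega>) * s (Z \<omega>))"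
      by (intro Bochner_Integration.integral_cong refl) (simp add: algebra_simps)
    also have "\<dots> = expectation (\<lambda>\<omega>. (X \<omega> - s (X \<omega>)) * Z \<omega>)
        + expectation (\<lambda>\<omega>. (Z \<omega> - s (Z \<omega>)) * s (X \<omega>)) + expectation (\<lambda>\<omega>. s (X \<omega>) * s (Z \<omega>))"
      using iX iZ by (simp add: integrable_product_of_squares)
    finally have split: "expectation (\<lambda>\<omega>. X \<omega> * Z \<omega>) = \<dots>" .
    have b1: "\<bar>expectation (\<lambda>\<omega>. (X \<omega> - s (X \<omega>)) * Z \<omega>)\<bar> \<le> t * q"
      by (rule abs_expectation_product_le) (use iX iZ eZ s(3) t in \<open>auto simp: X_def\<close>)
    have b2: "\<bar>expectation (\<lambda>\<omega>. (Z \<omega> - s (Z \<omega>)) * s (X \<omega>))\<bar> \<le> t * q"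
      by (rule abs_expectation_product_le) (use iX iZ eZ Es t in \<open>auto simp: X_def\<close>)
    have "\<bar>expectation (\<lambda>\<omega>. s (X \<omega>) * s (Z \<omega>)) - expectation (\<lambda>\<omega>. s (X \<omega>)) * expectation (\<lambda>\<omega>. s (Z \<omega>))\<bar>
        \<le> (\<Sum>u\<in>R. \<bar>u\<bar>)\<^sup>2 * alpha_mix M Y k"
    proof (rule finite_range_covariance_bound)
      fix u v
      have gen: "(\<lambda>\<omega>. s (Y i \<omega>)) -` {u} \<inter> space M \<in> sigma_gen M Y I" if "i \<in> I" for i u I
      proof -
        have "s -` {u} \<in> sets borel"
          using measurable_sets[of s borel borel "{u}"] by simp
        moreover have "(\<lambda>\<omega>. s (Y i \<omega>)) -` {u} \<inter> space M = Y i -` (s -` {u}) \<inter> space M" by auto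
        ultimately show ?thesis
          unfolding sigma_gen_def using that by (intro sigma_sets.Basic) blast
      qed
      \<comment> \<open>With \<open>m = 1\<close> the past consists of the index 1 and the future
        starts at \<open>k + 1\<close>, the index of \<open>Z\<close>.\<close>
      show "\<bar>prob ((\<lambda>\<omega>. s (X \<omega>)) -` {u} \<inter> space M) * prob ((\<lambda>\<omega>. s (Z \<omega>)) -` {v} \<inter> space M)
          - prob ((\<lambda>\<omega>. s (X \<omega>)) -` {u} \<inter> space M \<inter> ((\<lambda>\<omega>. s (Z \<omega>)) -` {v} \<inter> space M))\<bar> \<le> alpha_mix M Y k"
        unfolding X_def Z_def by (rule alpha_mix_upper[of _ Y 1]) (auto intro!: gen)
    qed (use R in \<open>auto simp: R_def\<close>)
    moreover have "\<bar>expectation (\<lambda>\<omega>. s (X \<omega>)) * expectation (\<lambda>\<omega>. s (Z \<omega>))\<bar> \<le> r * 1"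
      unfolding eZ(3) abs_mult using mean_s r by (intro mult_mono) (auto simp: X_def)
    ultimately have "\<bar>expectation (\<lambda>\<omega>. X \<omega> * Z \<omega>)\<bar> < e"
      using b1 b2 elim r t split by linarith
    then show ?case by (simp add: X_def Z_def)
  qed
qed

text \<open>Expanding the square gives \<open>l\<close> rows of product moments with weights at most
  \<open>S\<^sup>2\<close> in absolute value; by stationarity each row is a sum over lags, at most
  twice the sum over \<open>k < l\<close>.\<close>

lemma
  assumes stat: "strictly_stationary M Y" and sq: "integrable M (\<lambda>\<omega>. (Y 1 \<omega>)\<^sup>2)"
    and w: "\<And>i. i \<in> {a + 1..a + l} \<Longrightarrow> \<bar>w i\<bar> \<le> S"
  shows integrable_weighted_sum_sq:
      "integrable M (\<lambda>\<omega>. (\<Sum>i\<in>{a + 1..a + l}. w i * Y i \<omega>)\<^sup>2)"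
    and weighted_sum_second_moment_le:
      "expectation (\<lambda>\<omega>. (\<Sum>i\<in>{a + 1..a + l}. w i * Y i \<omega>)\<^sup>2)
        \<le> 2 * S\<^sup>2 * real l * (\<Sum>k<l. \<bar>expectation (\<lambda>\<omega>. Y 1 \<omega> * Y (Suc k) \<omega>)\<bar>)"
proof -
  let ?I = "{a + 1..a + l}"
  define c where "c k = \<bar>expectation (\<lambda>\<omega>. Y 1 \<omega> * Y (Suc k) \<omega>)\<bar>" for k
  have [measurable]: "Y k \<in> borel_measurable M" if "k \<ge> 1" for k
    using stat that by (auto simp: strictly_stationary_def)
  have sq': "integrable M (\<lambda>\<omega>. (Y i \<omega>)\<^sup>2)" if "i \<ge> 1" for i
    using strictly_stationary_integrable[OF stat that, of "\<lambda>x. x\<^sup>2"] sq by simp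
  have int: "integrable M (\<lambda>\<omega>. w i * w j * (Y i \<omega> * Y j \<omega>))" if "i \<in> ?I" "j \<in> ?I" for i j
    using that by (intro integrable_mult_right integrable_product_of_squares sq') auto
  have eq: "(\<Sum>i\<in>?I. w i * Y i \<omega>)\<^sup>2 = (\<Sum>i\<in>?I. \<Sum>j\<in>?I. w i * w j * (Y i \<omega> * Y j \<omega>))" for \<omega>
    unfolding power2_eq_square sum_product by (simp only: mult_ac)
  show "integrable M (\<lambda>\<omega>. (\<Sum>i\<in>?I. w i * Y i \<omega>)\<^sup>2)"
    unfolding eq by (intro Bochner_Integration.integrable_sum int)
  have mom: "\<bar>expectation (\<lambda>\<omega>. Y i \<omega> * Y j \<omega>)\<bar> = c (if i \<le> j then j - i else i - j)"
    if "i \<ge> 1" "j \<ge> 1" for i j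
    using strictly_stationary_product_moment[OF stat that(1), of j]
      strictly_stationary_product_moment[OF stat that(2), of i]
    by (auto simp: c_def mult.commute)
  have "expectation (\<lambda>\<omega>. (\<Sum>i\<in>?I. w i * Y i \<omega>)\<^sup>2)
      = (\<Sum>i\<in>?I. expectation (\<lambda>\<omega>. \<Sum>j\<in>?I. w i * w j * (Y i \<omega> * Y j \<omega>)))"
    unfolding eq by (intro Bochner_Integration.integral_sum Bochner_Integration.integrable_sum int)
  also have "\<dots> = (\<Sum>i\<in>?I. \<Sum>j\<in>?I. expectation (\<lambda>\<omega>. w i * w j * (Y i \<omega> * Y j \<omega>)))"
    by (intro sum.cong refl Bochner_Integration.integral_sum int)
  also have "\<dots> = (\<Sum>i\<in>?I. \<Sum>j\<in>?I. w i * w j * expectation (\<lambda>\<omega>. Y i \<omega> * Y j \<omega>))"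
    by (simp only: integral_mult_right_zero)
  also have "\<dots> \<le> (\<Sum>i\<in>?I. \<Sum>j\<in>?I. S\<^sup>2 * c (if i \<le> j then j - i else i - j))"
  proof (intro sum_mono)
    fix i j assume ij: "i \<in> ?I" "j \<in> ?I"
    have ww: "\<bar>w i\<bar> * \<bar>w j\<bar> \<le> S\<^sup>2"
      unfolding power2_eq_square using w[OF ij(1)] w[OF ij(2)] by (intro mult_mono) auto
    have mij: "\<bar>expectation (\<lambda>\<omega>. Y i \<omega> * Y j \<omega>)\<bar> = c (if i \<le> j then j - i else i - j)"
      using ij by (intro mom) auto
    have "\<bar>w i * w j * expectation (\<lambda>\<omega>. Y i \<omega> * Y j \<omega>)\<bar> \<le> S\<^sup>2 * c (if i \<le> j then j - i else i - j)"
      unfolding abs_mult mij by (rule mult_right_mono[OF ww]) (simp add: c_def)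
    then show "w i * w j * expectation (\<lambda>\<omega>. Y i \<omega> * Y j \<omega>) \<le> S\<^sup>2 * c (if i \<le> j then j - i else i - j)"
      by (rule order.trans[OF abs_ge_self])
  qed
  also have "\<dots> = S\<^sup>2 * (\<Sum>i\<in>?I. \<Sum>j\<in>?I. c (if i \<le> j then j - i else i - j))"
    by (simp only: sum_distrib_left)
  also have "\<dots> \<le> S\<^sup>2 * (\<Sum>i\<in>?I. 2 * (\<Sum>k<l. c k))"
    by (intro mult_left_mono sum_mono sum_lag_le) (auto simp: c_def)
  also have "\<dots> = 2 * S\<^sup>2 * real l * (\<Sum>k<l. c k)" by simp
  finally show "expectation (\<lambda>\<omega>. (\<Sum>i\<in>?I. w i * Y i \<omega>)\<^sup>2)
      \<le> 2 * S\<^sup>2 * real l * (\<Sum>k<l. \<bar>expectation (\<lambda>\<omega>. Y 1 \<omega> * Y (Suc k) \<omega>)\<bar>)"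
    by (simp add: c_def)
qed

end

subsection \<open>Convergence in mean square\<close>

lemma borel_measurable_gini_stat:
  assumes [measurable]: "\<And>i. i \<ge> 1 \<Longrightarrow> X i \<in> borel_measurable M"
  shows "gini_stat l b X \<in> borel_measurable M"
  unfolding gini_stat_def[abs_def] local_mean_def case_prod_unfold by measurable

text \<open>By the perturbation bound and Cauchy-Schwarz the squared error is at most
  \<open>4 / b\<close> times the sum of the squared noise means. Each of these has expectation at
  most \<open>2 * S\<^sup>2 * (C / l)\<close>, whence the constant 8.\<close>

lemma (in prob_space)
  assumes stat: "strictly_stationary M Y" and sq: "integrable M (\<lambda>\<omega>. (Y 1 \<omega>)\<^sup>2)"
    and l: "l > 0" and b: "b \<ge> 2"
    and w: "\<And>i. i \<in> {1..l * b} \<Longrightarrow> \<bar>w i\<bar> \<le> S"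
  shows integrable_gini_stat_error_sq:
      "integrable M (\<lambda>\<omega>. (gini_stat l b (\<lambda>i \<omega>. m i + w i * Y i \<omega>) \<omega> - gini_stat l b (\<lambda>i _. m i) \<omega>)\<^sup>2)"
      (is "integrable M ?E")
    and gini_stat_error_second_moment_le:
      "expectation (\<lambda>\<omega>. (gini_stat l b (\<lambda>i \<omega>. m i + w i * Y i \<omega>) \<omega> - gini_stat l b (\<lambda>i _. m i) \<omega>)\<^sup>2)
        \<le> 8 * S\<^sup>2 * ((\<Sum>k<l. \<bar>expectation (\<lambda>\<omega>. Y 1 \<omega> * Y (Suc k) \<omega>)\<bar>) / real l)"
proof -
  define e where "e j = local_mean l (\<lambda>i \<omega>. w i * Y i \<omega>) j" for j
  define C where "C = (\<Sum>k<l. \<bar>expectation (\<lambda>\<omega>. Y 1 \<omega> * Y (Suc k) \<omega>)\<bar>)"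
  have [measurable]: "Y k \<in> borel_measurable M" if "k \<ge> 1" for k
    using stat that by (auto simp: strictly_stationary_def)
  have block: "integrable M (\<lambda>\<omega>. (e j \<omega>)\<^sup>2)" "expectation (\<lambda>\<omega>. (e j \<omega>)\<^sup>2) \<le> 2 * S\<^sup>2 * (C / real l)"
    if j: "j \<in> {1..b}" for j
  proof -
    \<comment> \<open>Writes the block end as \<open>a + l\<close> with
      \<open>a = (j - 1) * l\<close>, the form in which weighted sums are estimated.\<close>
    have jl: "j * l = (j - 1) * l + l" using j by (cases j) auto
    have "(j - 1) * l + l \<le> l * b"
      using j unfolding jl[symmetric] by (simp add: mult.commute)
    then have w': "\<bar>w i\<bar> \<le> S" if "i \<in> {(j - 1) * l + 1..(j - 1) * l + l}" for i
      using that by (intro w) auto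
    have sq_e: "(e j \<omega>)\<^sup>2 = (\<Sum>i\<in>{(j - 1) * l + 1..(j - 1) * l + l}. w i * Y i \<omega>)\<^sup>2 / (real l)\<^sup>2" for \<omega>
      by (simp only: e_def local_mean_def jl power_divide)
    show "integrable M (\<lambda>\<omega>. (e j \<omega>)\<^sup>2)"
      unfolding sq_e by (intro integrable_divide integrable_weighted_sum_sq[OF stat sq w'])
    have "expectation (\<lambda>\<omega>. (e j \<omega>)\<^sup>2) \<le> 2 * S\<^sup>2 * real l * C / (real l)\<^sup>2"
      unfolding sq_e integral_divide_zero C_def
      by (intro divide_right_mono weighted_sum_second_moment_le[OF stat sq w']) auto
    also have "\<dots> = 2 * S\<^sup>2 * (C / real l)"
      using l by (simp add: power2_eq_square)
    finally show "expectation (\<lambda>\<omega>. (e j \<omega>)\<^sup>2) \<le> 2 * S\<^sup>2 * (C / real l)" .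
  qed
  have bound: "?E \<omega> \<le> 4 / real b * (\<Sum>j=1..b. (e j \<omega>)\<^sup>2)" for \<omega>
  proof -
    have "?E \<omega> \<le> (2 / real b * (\<Sum>j=1..b. \<bar>e j \<omega>\<bar>))\<^sup>2"
      unfolding e_def by (rule power2_le_iff_abs_le[THEN iffD2])
        (use gini_stat_perturbation[OF b, of l "\<lambda>i _. m i" "\<lambda>i \<omega>. w i * Y i \<omega>" \<omega>]
          in \<open>auto intro!: mult_nonneg_nonneg sum_nonneg\<close>)
    also have "\<dots> = 4 / (real b)\<^sup>2 * (\<Sum>j=1..b. \<bar>e j \<omega>\<bar>)\<^sup>2"
      by (simp add: power_mult_distrib power_divide)
    also have "\<dots> \<le> 4 / (real b)\<^sup>2 * ((\<Sum>j=1..b. (e j \<omega>)\<^sup>2) * real b)"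
      using sum_squared_le_sum_of_squares[of "\<lambda>j. \<bar>e j \<omega>\<bar>" "{1..b}"]
      by (intro mult_left_mono) auto
    also have "\<dots> = 4 / real b * (\<Sum>j=1..b. (e j \<omega>)\<^sup>2)"
      using b by (simp add: power2_eq_square)
    finally show ?thesis .
  qed
  have int: "integrable M (\<lambda>\<omega>. 4 / real b * (\<Sum>j=1..b. (e j \<omega>)\<^sup>2))"
    by (intro integrable_mult_right Bochner_Integration.integrable_sum block)
  have meas: "?E \<in> borel_measurable M"
    by (intro borel_measurable_power borel_measurable_diff borel_measurable_gini_stat) measurable
  show intE: "integrable M ?E"
    by (rule Bochner_Integration.integrable_bound[OF int meas])
      (simp only: real_norm_def abs_power2, intro AE_I2 order.trans[OF bound abs_ge_self])
  have "expectation ?E \<le> expectation (\<lambda>\<omega>. 4 / real b * (\<Sum>j=1..b. (e j \<omega>)\<^sup>2))"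
    by (intro integral_mono intE int bound)
  also have "\<dots> = 4 / real b * (\<Sum>j=1..b. expectation (\<lambda>\<omega>. (e j \<omega>)\<^sup>2))"
    by (simp only: integral_mult_right_zero Bochner_Integration.integral_sum block(1))
  also have "\<dots> \<le> 4 / real b * (\<Sum>j=1..b. 2 * S\<^sup>2 * (C / real l))"
    by (intro mult_left_mono sum_mono block) auto
  also have "\<dots> = 8 * S\<^sup>2 * (C / real l)" using b by simp
  finally show "expectation ?E \<le> 8 * S\<^sup>2 * ((\<Sum>k<l. \<bar>expectation (\<lambda>\<omega>. Y 1 \<omega> * Y (Suc k) \<omega>)\<bar>) / real l)"
    by (simp add: C_def)
qed

section \<open>Admissible sample sizes and the limit theorem\<close>

lemma filterlim_nat_floor_powr:
  assumes "s > 0"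
  shows "filterlim (\<lambda>n. nat \<lfloor>real n powr s\<rfloor>) at_top sequentially"
proof -
  have "filterlim (\<lambda>x::real. x powr s) at_top at_top"
    unfolding filterlim_at_top
  proof
    fix Z :: real
    have "\<forall>\<^sub>F x::real in at_top. x \<ge> max 1 (max 1 Z powr (1 / s))"
      by (rule eventually_ge_at_top)
    then show "\<forall>\<^sub>F x::real in at_top. Z \<le> x powr s"
    proof eventually_elim
      case (elim x)
      have "Z \<le> (max 1 Z powr (1 / s)) powr s"
        using assms by (simp add: powr_powr)
      also have "\<dots> \<le> x powr s"
        using elim assms by (intro powr_mono2) auto
      finally show ?case .
    qed
  qed
  then show ?thesis
    by (intro filterlim_compose[OF filterlim_nat_sequentially]
        filterlim_compose[OF filterlim_floor_sequentially]
        filterlim_compose[OF _ filterlim_real_sequentially])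
qed

text \<open>Integrality makes the floors exact, so the exponents \<open>s\<close> and
  \<open>1 - s\<close> add up to 1. The size 0 is excluded because it is admissible but has blocks
  of length 0.\<close>

lemma block_length_mult_block_count:
  assumes "n \<in> admissible_sizes s" "n > 0"
  shows "block_length s n > 0" "block_count s n > 0" "block_length s n * block_count s n = n"
proof -
  have nat: "real (nat \<lfloor>x\<rfloor>) = x" if "x \<in> \<nat>" for x :: real
    using that by (auto elim: Nats_cases)
  have mem: "real n powr s \<in> \<nat>" "real n powr (1 - s) \<in> \<nat>"
    using assms(1) by (simp_all add: admissible_sizes_def)
  have l: "real (block_length s n) = real n powr s" and b: "real (block_count s n) = real n powr (1 - s)"
    unfolding block_length_def block_count_def by (simp_all only: nat mem)
  have "real n powr s > 0" "real n powr (1 - s) > 0" using assms(2) by simp_all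
  then show "block_length s n > 0" "block_count s n > 0"
    unfolding l[symmetric] b[symmetric] by simp_all
  have "real (block_length s n * block_count s n) = real n powr (s + (1 - s))"
    by (simp add: l b powr_add[symmetric])
  also have "\<dots> = real n" using assms(2) by simp
  finally show "block_length s n * block_count s n = n" by (simp only: of_nat_eq_iff)
qed

lemma tendsto_gini_stat_sample_admissible:
  assumes "s < 1" "cadlag01 f"
  shows "((\<lambda>n. gini_stat (block_length s n) (block_count s n) (\<lambda>i _. f (real i / real n)) \<omega>)
            \<longlongrightarrow> (LBINT y:{0..1}. (LBINT x:{0..1}. \<bar>f x - f y\<bar>))) (admissible_at_top s)"
proof -
  define P where "P n \<longleftrightarrow> n \<in> admissible_sizes s \<and> n > 0" for n
  \<comment> \<open>Blocks of length 1 at the inadmissible sizes let the block count diverge along all \<open>n\<close>, as the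
    sequential dominated convergence theorem requires.\<close>
  define l where "l n = (if P n then block_length s n else 1)" for n
  define b where "b n = (if P n then block_count s n else Suc n)" for n
  have pos: "l n > 0" "b n > 0" for n
    using block_length_mult_block_count[of n s] by (auto simp: l_def b_def P_def)
  have count: "filterlim (block_count s) at_top sequentially"
    using filterlim_nat_floor_powr[of "1 - s"] assms(1) by (simp add: block_count_def[abs_def])
  have "filterlim b at_top sequentially"
    unfolding filterlim_at_top
  proof
    fix Z
    have "\<forall>\<^sub>F n in sequentially. Z \<le> block_count s n"
      using count by (simp add: filterlim_at_top)
    then show "\<forall>\<^sub>F n in sequentially. Z \<le> b n"
      using eventually_ge_at_top[of Z] by eventually_elim (auto simp: b_def)
  qed
  from tendsto_gini_stat_sample[OF pos this assms(2)]
  have "((\<lambda>n. gini_stat (l n) (b n) (\<lambda>i _. f (real i / real (l n * b n))) \<omega>)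
      \<longlongrightarrow> (LBINT y:{0..1}. (LBINT x:{0..1}. \<bar>f x - f y\<bar>))) (admissible_at_top s)"
    by (rule tendsto_mono[rotated]) (simp add: admissible_at_top_def)
  \<comment> \<open>At positive admissible sizes \<open>l n * b n = n\<close>, so the sample points
    agree.\<close>
  moreover have "\<forall>\<^sub>F n in admissible_at_top s.
      gini_stat (l n) (b n) (\<lambda>i _. f (real i / real (l n * b n))) \<omega>
      = gini_stat (block_length s n) (block_count s n) (\<lambda>i _. f (real i / real n)) \<omega>"
    unfolding admissible_at_top_def eventually_inf_principal
    using eventually_gt_at_top[of 0]
    by eventually_elim (auto simp: l_def b_def P_def block_length_mult_block_count(3))
  ultimately show ?thesis by (rule Lim_transform_eventually)
qed

lemma gini_stat_deterministic: "gini_stat l b (\<lambda>i _. m i) \<omega> = gini_stat l b (\<lambda>i _. m i) \<omega>'"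
  by (simp add: gini_stat_def local_mean_def)

theorem theorem2p3:
  fixes M :: "'a measure"
    and Y :: "nat \<Rightarrow> 'a \<Rightarrow> real"
    and \<mu> \<sigma> :: "real \<Rightarrow> real"
    and \<sigma>\<^sub>0 s \<delta> :: real
  assumes "prob_space M"
    and "strictly_stationary M Y"
    and "prob_space.expectation M (Y 1) = 0"
    and "prob_space.variance M (Y 1) = 1"
    and "alpha_mixing M Y"
    and "long_run_variance M Y > 0"
    and "cadlag01 \<sigma>"
    and "piecewise_lipschitz01 \<sigma>"
    and "\<sigma>\<^sub>0 > 0"
    and "\<forall>x\<in>{0..1}. \<sigma> x \<ge> \<sigma>\<^sub>0"
    and "1 / 2 < s" and "s < 1"
    and "\<delta> > 0"
    and "integrable M (\<lambda>\<omega>. \<bar>Y 1 \<omega>\<bar> powr (2 + \<delta>))"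
    and "summable (\<lambda>k. alpha_mix M Y (Suc k) powr (\<delta> / (2 + \<delta>)))"
    and "cadlag01 \<mu>"
  shows "tendsto_in_L2 M (admissible_at_top s) (U_stat \<mu> \<sigma> Y s)
           (\<lambda>_. LBINT y:{0..1}. (LBINT x:{0..1}. \<bar>\<mu> x - \<mu> y\<bar>))"
proof -
  interpret prob_space M by fact
  note stat = assms(2)
  let ?F = "admissible_at_top s"
  define J where "J = (LBINT y:{0..1}. (LBINT x:{0..1}. \<bar>\<mu> x - \<mu> y\<bar>))"
  \<comment> \<open>The noiseless statistic is the same at every outcome; \<open>()\<close> is a
    dummy outcome that makes \<open>D n\<close> a number.\<close>
  define D where "D n = gini_stat (block_length s n) (block_count s n) (\<lambda>i _. \<mu> (real i / real n)) ()" for n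
  define U where "U = U_stat \<mu> \<sigma> Y s"
  define h where "h l = (\<Sum>k<l. \<bar>expectation (\<lambda>\<omega>. Y 1 \<omega> * Y (Suc k) \<omega>)\<bar>) / real l" for l
  have Y[measurable]: "Y i \<in> borel_measurable M" if "i \<ge> 1" for i
    using stat that by (auto simp: strictly_stationary_def)
  \<comment> \<open>For a centred variable the variance is the integral of the square. It equals 1,
    whereas the integral of a non-integrable function would be 0.\<close>
  have sq: "integrable M (\<lambda>\<omega>. (Y 1 \<omega>)\<^sup>2)"
    using assms(3,4) not_integrable_integral_eq[of M "\<lambda>\<omega>. (Y 1 \<omega>)\<^sup>2"] by force
  obtain S where S: "\<And>x. x \<in> {0..1} \<Longrightarrow> \<bar>\<sigma> x\<bar> \<le> S"
    using cadlag01_bounded[OF assms(7)] by blast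
  have F: "?F \<le> sequentially" by (simp add: admissible_at_top_def)
  have l_top: "filterlim (block_length s) at_top ?F" and b_top: "filterlim (block_count s) at_top ?F"
    using filterlim_mono[OF filterlim_nat_floor_powr[of s] order_refl F]
      filterlim_mono[OF filterlim_nat_floor_powr[of "1 - s"] order_refl F] assms(11,12)
    by (simp_all add: block_length_def[abs_def] block_count_def[abs_def])
  have D: "(D \<longlongrightarrow> J) ?F"
    unfolding D_def[abs_def] J_def using assms(12,16) by (rule tendsto_gini_stat_sample_admissible)
  have h: "((\<lambda>n. h (block_length s n)) \<longlongrightarrow> 0) ?F"
  proof -
    have "(\<lambda>k. \<bar>expectation (\<lambda>\<omega>. Y 1 \<omega> * Y (Suc k) \<omega>)\<bar>) \<longlonglongrightarrow> 0"
      using mixing_product_moment_tendsto_0[OF stat assms(5,3) sq] by (rule tendsto_rabs_zero)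
    then have "h \<longlonglongrightarrow> 0"
      unfolding h_def[abs_def] by (rule cesaro_tendsto_0) simp
    then show ?thesis using l_top by (rule filterlim_compose)
  qed
  have U_meas: "U n \<in> borel_measurable M" for n
    unfolding U_def U_stat_def
    by (intro borel_measurable_gini_stat) (simp add: obs_def[abs_def])
  have "\<forall>\<^sub>F n in ?F. block_count s n \<ge> 2"
    using b_top by (simp add: filterlim_at_top)
  moreover have "\<forall>\<^sub>F n in ?F. n \<in> admissible_sizes s \<and> n > 0"
    unfolding admissible_at_top_def eventually_inf_principal
    using eventually_gt_at_top[of 0] by eventually_elim auto
  ultimately have ev: "\<forall>\<^sub>F n in ?F. integrable M (\<lambda>\<omega>. (U n \<omega> - D n)\<^sup>2)
      \<and> expectation (\<lambda>\<omega>. (U n \<omega> - D n)\<^sup>2) \<le> 8 * S\<^sup>2 * h (block_length s n)"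
  proof eventually_elim
    case (elim n)
    let ?l = "block_length s n" and ?b = "block_count s n"
    have l: "?l > 0" and n: "?l * ?b = n"
      using block_length_mult_block_count elim(2) by auto
    have w: "\<bar>\<sigma> (real i / real n)\<bar> \<le> S" if "i \<in> {1..?l * ?b}" for i
      using that by (intro S) (auto simp: n divide_le_eq_1)
    have eq: "U n \<omega> - D n
        = gini_stat ?l ?b (\<lambda>i \<omega>. \<mu> (real i / real n) + \<sigma> (real i / real n) * Y i \<omega>) \<omega>
          - gini_stat ?l ?b (\<lambda>i _. \<mu> (real i / real n)) \<omega>" for \<omega>
      unfolding U_def U_stat_def D_def
      by (subst gini_stat_deterministic[of _ _ _ "()" \<omega>]) (simp add: obs_def[abs_def])
    show ?case
      unfolding eq h_def
      by (intro conjI integrable_gini_stat_error_sq[where S = S] gini_stat_error_second_moment_le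
          stat sq l elim(1) w)
  qed
  have sum_sq: "(x + y)\<^sup>2 \<le> 2 * x\<^sup>2 + 2 * y\<^sup>2" for x y :: real
    using sum_squares_bound[of x y] by (simp add: power2_sum)
  \<comment> \<open>Used with \<open>c = J\<close> for the limit and with \<open>c = 0\<close> for
    square integrability of the statistic itself.\<close>
  have int: "integrable M (\<lambda>\<omega>. (U n \<omega> - c)\<^sup>2)"
    if "integrable M (\<lambda>\<omega>. (U n \<omega> - D n)\<^sup>2)" for n c
  proof (rule Bochner_Integration.integrable_bound)
    show "integrable M (\<lambda>\<omega>. 2 * (U n \<omega> - D n)\<^sup>2 + 2 * (D n - c)\<^sup>2)"
      using that by simp
    show "(\<lambda>\<omega>. (U n \<omega> - c)\<^sup>2) \<in> borel_measurable M" using U_meas by measurable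
    show "AE \<omega> in M. norm ((U n \<omega> - c)\<^sup>2) \<le> norm (2 * (U n \<omega> - D n)\<^sup>2 + 2 * (D n - c)\<^sup>2)"
      using sum_sq[of "U n _ - D n" "D n - c"] by (intro AE_I2) simp
  qed
  have "((\<lambda>n. expectation (\<lambda>\<omega>. (U n \<omega> - J)\<^sup>2)) \<longlongrightarrow> 0) ?F"
  proof (rule tendsto_sandwich[OF _ _ tendsto_const])
    show "\<forall>\<^sub>F n in ?F. 0 \<le> expectation (\<lambda>\<omega>. (U n \<omega> - J)\<^sup>2)" by simp
    \<comment> \<open>The error is split at \<open>D n\<close> into noise and discretisation; the 16
      is twice the constant 8 of the noise bound.\<close>
    show "\<forall>\<^sub>F n in ?F. expectation (\<lambda>\<omega>. (U n \<omega> - J)\<^sup>2)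
        \<le> 16 * S\<^sup>2 * h (block_length s n) + 2 * (D n - J)\<^sup>2"
      using ev
    proof eventually_elim
      case (elim n)
      have "expectation (\<lambda>\<omega>. (U n \<omega> - J)\<^sup>2)
          \<le> expectation (\<lambda>\<omega>. 2 * (U n \<omega> - D n)\<^sup>2 + 2 * (D n - J)\<^sup>2)"
        using elim int sum_sq[of "U n _ - D n" "D n - J"] by (intro integral_mono) auto
      also have "\<dots> = 2 * expectation (\<lambda>\<omega>. (U n \<omega> - D n)\<^sup>2) + 2 * (D n - J)\<^sup>2"
        using elim prob_space by simp
      also have "\<dots> \<le> 16 * S\<^sup>2 * h (block_length s n) + 2 * (D n - J)\<^sup>2"
        using conjunct2[OF elim] by linarith
      finally show ?case .
    qed
    have "((\<lambda>n. 16 * S\<^sup>2 * h (block_length s n) + 2 * (D n - J)\<^sup>2)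
        \<longlongrightarrow> 16 * S\<^sup>2 * 0 + 2 * (J - J)\<^sup>2) ?F"
      by (intro tendsto_intros h D)
    then show "((\<lambda>n. 16 * S\<^sup>2 * h (block_length s n) + 2 * (D n - J)\<^sup>2) \<longlongrightarrow> 0) ?F" by simp
  qed
  moreover have "\<forall>\<^sub>F n in ?F. U n \<in> borel_measurable M \<and> integrable M (\<lambda>\<omega>. (U n \<omega>)\<^sup>2)"
    using ev by eventually_elim (use U_meas int[of _ 0] in auto)
  ultimately show ?thesis
    unfolding tendsto_in_L2_def J_def[symmetric] U_def[symmetric] by simp
qed

end
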